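(* Let $K$ be a field, let $E$ be a row-finite graph satisfying Condition (L), and let $J$ be a regular ideal in the Leavitt path algebra $L_K(E)$. Then the quotient graph $E/H(J)$ satisfies Condition (L) and $L_K(E)/J\simeq L_K(E/H(J))$.
   Context: A graph $E=(E^0,E^1,r,s)$ consists of a countable set of vertices $E^0$, a countable set of edges $E^1$, and range and source maps $r,s:E^1\to E^0$. It is row-finite if $s^{-1}(v)$ is finite for each vertex $v$. A nontrivial path is $\alpha=e_1\cdots e_n$ with $r(e_i)=s(e_{i+1})$ for $1\le i\le n-1$; $s(\alpha)=s(e_1)$, $r(\alpha)=r(e_n)$. Vertices are paths of length $0$ (with $s(v)=r(v)=v$). $E^*$ is the set of all finite paths. $E^0_{reg}$ is the set of vertices $v$ with $s^{-1}(v)$ nonempty and finite. A path $\alpha=e_1\cdots e_n$ is a cycle if $r(e_n)=s(e_1)$ and $s(e_i)\ne s(e_j)$ for all $i\ne j$. An exit for $\alpha$ is an edge $e$ such that $s(e)=s(e_i)$ for some $i$ but $e\ne e_i$. A graph satisfies Condition (L) if every cycle has an exit. The Leavitt path algebra $L_K(E)$ is the universal $K$-algebra generated by pairwise orthogonal idempotents $\{v:v\in E^0\}$ and elements $\{e,e^*:e\in E^1\}$ subject to: (1) $s(e)e=er(e)=e$ for all $e\in E^1$; (2) $r(e)e^*=e^*s(e)=e^*$ for all $e\in E^1$; (3) $e^*f=\delta_{e,f}\,r(e)$ for all $e,f\in E^1$; (4) $v=\sum_{e\in E^1,\,s(e)=v}ee^*$ for all $v\in E^0_{reg}$. For a subset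 $X$ of an algebra $A$, $X^\perp=\{a\in A: ax=xa=0\text{ for all }x\in X\}$. A (two-sided) ideal $J\subseteq A$ is called regular if $J=J^{\perp\perp}$. For an ideal $J$ of $L_K(E)$, $H(J)=\{v\in E^0: v\in J\}$; this set is hereditary, where $H\subseteq E^0$ is hereditary if $\alpha\in E^*$ and $s(\alpha)\in H$ imply $r(\alpha)\in H$. The quotient graph $E/H$ of $E$ by a hereditary set $H$ has $(E/H)^0=E^0\setminus H$, $(E/H)^1=\{e\in E^1: r(e)\notin H\}$, with range and source maps restricted from $E$. The symbol $\simeq$ denotes isomorphism of $K$-algebras. *)

theory Defs
  imports
    "HOL-Library.Poly_Mapping"
    "HOL-Library.Countable_Set"
    "Graph_Theory.Arc_Walk"
begin

section \<open>Directed graphs\<close>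

text \<open>
  A graph \<open>(E\<^sup>0, E\<^sup>1, r, s)\<close> is a well-formed multi-digraph with \<^const>\<open>verts\<close> for \<open>E\<^sup>0\<close>,
  \<^const>\<open>arcs\<close> for \<open>E\<^sup>1\<close>, \<^const>\<open>head\<close> for \<open>r\<close> and \<^const>\<open>tail\<close> for \<open>s\<close>.
  The paths from \<open>u\<close> to \<open>v\<close> are the arc walks \<open>pre_digraph.awalk E u p v\<close>.
\<close>

definition countable_digraph :: "('v, 'e) pre_digraph \<Rightarrow> bool" where
  "countable_digraph E \<longleftrightarrow> wf_digraph E \<and> countable (verts E) \<and> countable (arcs E)"

definition row_finite :: "('v, 'e) pre_digraph \<Rightarrow> bool" where
  "row_finite E \<longleftrightarrow> (\<forall>v \<in> verts E. finite (out_arcs E v))"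

definition regular_verts :: "('v, 'e) pre_digraph \<Rightarrow> 'v set" where
  "regular_verts E = {v \<in> verts E. out_arcs E v \<noteq> {} \<and> finite (out_arcs E v)}"

text \<open>
  The library's \<^const>\<open>pre_digraph.cycle\<close> forbids repetitions among the range vertices of a closed
  nontrivial path; since the path is closed, these are also its source vertices.
\<close>

lemma (in wf_digraph) cycle_iff_distinct_tails:
  "cycle p \<longleftrightarrow> p \<noteq> [] \<and> (\<exists>u. awalk u p u) \<and> distinct (map (tail G) p)"
proof -
  have tls: "awalk_verts u q = map (tail G) q @ [w]" if "awalk u q w" for u q w
    using that by (induction q arbitrary: u) (auto simp: awalk_simps)
  have "distinct (tl (awalk_verts u p)) \<longleftrightarrow> distinct (map (tail G) p)"
    if "awalk u p u" "p \<noteq> []" for u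
    using tls[OF that(1)] that by (cases p) (auto simp: awalk_simps)
  then show ?thesis unfolding cycle_def by blast
qed

definition is_exit :: "('v, 'e) pre_digraph \<Rightarrow> 'e list \<Rightarrow> 'e \<Rightarrow> bool" where
  "is_exit E p e \<longleftrightarrow>
     e \<in> arcs E \<and> (\<exists>i < length p. tail E e = tail E (p ! i) \<and> e \<noteq> p ! i)"

definition condition_L :: "('v, 'e) pre_digraph \<Rightarrow> bool" where
  "condition_L E \<longleftrightarrow> (\<forall>p. pre_digraph.cycle E p \<longrightarrow> (\<exists>e. is_exit E p e))"

definition hereditary :: "('v, 'e) pre_digraph \<Rightarrow> 'v set \<Rightarrow> bool" where
  "hereditary E H \<longleftrightarrow>
     H \<subseteq> verts E \<and> (\<forall>u p v. pre_digraph.awalk E u p v \<longrightarrow> u \<in> H \<longrightarrow> v \<in> H)"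

definition quotient_graph :: "('v, 'e) pre_digraph \<Rightarrow> 'v set \<Rightarrow> ('v, 'e) pre_digraph" where
  "quotient_graph E H =
     \<lparr> verts = verts E - H, arcs = {e \<in> arcs E. head E e \<notin> H}, tail = tail E, head = head E \<rparr>"

lemma wf_digraph_quotient_graph:
  assumes "wf_digraph E" "hereditary E H"
  shows "wf_digraph (quotient_graph E H)"
proof -
  interpret wf_digraph E by fact
  show ?thesis
    using assms(2) arc_implies_awalk
    by unfold_locales (fastforce simp: quotient_graph_def hereditary_def)+
qed


section \<open>Algebras without unit over a field\<close>

text \<open>Leavitt path algebras of graphs with infinitely many vertices have no unit.\<close>

record ('k, 'a) algebra_structure =
  acarrier :: "'a set"
  azero :: 'a
  aadd :: "'a \<Rightarrow> 'a \<Rightarrow> 'a"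
  amult :: "'a \<Rightarrow> 'a \<Rightarrow> 'a"
  ascale :: "'k \<Rightarrow> 'a \<Rightarrow> 'a"

locale nonunital_algebra =
  fixes A :: "('k::field, 'a) algebra_structure"
  assumes zero_closed: "azero A \<in> acarrier A"
    and add_closed: "\<lbrakk>x \<in> acarrier A; y \<in> acarrier A\<rbrakk> \<Longrightarrow> aadd A x y \<in> acarrier A"
    and mult_closed: "\<lbrakk>x \<in> acarrier A; y \<in> acarrier A\<rbrakk> \<Longrightarrow> amult A x y \<in> acarrier A"
    and scale_closed: "x \<in> acarrier A \<Longrightarrow> ascale A c x \<in> acarrier A"
    and add_assoc: "\<lbrakk>x \<in> acarrier A; y \<in> acarrier A; z \<in> acarrier A\<rbrakk>
      \<Longrightarrow> aadd A (aadd A x y) z = aadd A x (aadd A y z)"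
    and add_commute: "\<lbrakk>x \<in> acarrier A; y \<in> acarrier A\<rbrakk> \<Longrightarrow> aadd A x y = aadd A y x"
    and add_zero: "x \<in> acarrier A \<Longrightarrow> aadd A (azero A) x = x"
    and add_inverse: "x \<in> acarrier A \<Longrightarrow> aadd A x (ascale A (- 1) x) = azero A"
    and mult_assoc: "\<lbrakk>x \<in> acarrier A; y \<in> acarrier A; z \<in> acarrier A\<rbrakk>
      \<Longrightarrow> amult A (amult A x y) z = amult A x (amult A y z)"
    and distrib_left: "\<lbrakk>x \<in> acarrier A; y \<in> acarrier A; z \<in> acarrier A\<rbrakk>
      \<Longrightarrow> amult A x (aadd A y z) = aadd A (amult A x y) (amult A x z)"
    and distrib_right: "\<lbrakk>x \<in> acarrier A; y \<in> acarrier A; z \<in> acarrier A\<rbrakk>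
      \<Longrightarrow> amult A (aadd A x y) z = aadd A (amult A x z) (amult A y z)"
    and scale_add: "\<lbrakk>x \<in> acarrier A; y \<in> acarrier A\<rbrakk>
      \<Longrightarrow> ascale A c (aadd A x y) = aadd A (ascale A c x) (ascale A c y)"
    and add_scale: "x \<in> acarrier A \<Longrightarrow> ascale A (c + d) x = aadd A (ascale A c x) (ascale A d x)"
    and scale_scale: "x \<in> acarrier A \<Longrightarrow> ascale A c (ascale A d x) = ascale A (c * d) x"
    and scale_one: "x \<in> acarrier A \<Longrightarrow> ascale A 1 x = x"
    and scale_mult_left: "\<lbrakk>x \<in> acarrier A; y \<in> acarrier A\<rbrakk>
      \<Longrightarrow> amult A (ascale A c x) y = ascale A c (amult A x y)"
    and scale_mult_right: "\<lbrakk>x \<in> acarrier A; y \<in> acarrier A\<rbrakk>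
      \<Longrightarrow> amult A x (ascale A c y) = ascale A c (amult A x y)"

text \<open>Ideals are taken to be linear subspaces; in a Leavitt path algebra this is automatic
  because of the local units.\<close>

definition two_sided_ideal :: "('k, 'a) algebra_structure \<Rightarrow> 'a set \<Rightarrow> bool" where
  "two_sided_ideal A J \<longleftrightarrow>
     J \<subseteq> acarrier A \<and> azero A \<in> J \<and>
     (\<forall>x \<in> J. \<forall>y \<in> J. aadd A x y \<in> J) \<and>
     (\<forall>c. \<forall>x \<in> J. ascale A c x \<in> J) \<and>
     (\<forall>x \<in> J. \<forall>a \<in> acarrier A. amult A a x \<in> J \<and> amult A x a \<in> J)"

definition perp :: "('k, 'a) algebra_structure \<Rightarrow> 'a set \<Rightarrow> 'a set" where
  "perp A X = {a \<in> acarrier A. \<forall>x \<in> X. amult A a x = azero A \<and> amult A x a = azero A}"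

definition regular_ideal :: "('k, 'a) algebra_structure \<Rightarrow> 'a set \<Rightarrow> bool" where
  "regular_ideal A J \<longleftrightarrow> two_sided_ideal A J \<and> J = perp A (perp A J)"

definition ideal_coset :: "('k, 'a) algebra_structure \<Rightarrow> 'a set \<Rightarrow> 'a \<Rightarrow> 'a set" where
  "ideal_coset A J a = aadd A a ` J"

definition quotient_algebra ::
    "('k, 'a) algebra_structure \<Rightarrow> 'a set \<Rightarrow> ('k, 'a set) algebra_structure" where
  "quotient_algebra A J =
     \<lparr> acarrier = ideal_coset A J ` acarrier A,
       azero = ideal_coset A J (azero A),
       aadd = (\<lambda>X Y. \<Union>x \<in> X. \<Union>y \<in> Y. ideal_coset A J (aadd A x y)),
       amult = (\<lambda>X Y. \<Union>x \<in> X. \<Union>y \<in> Y. ideal_coset A J (amult A x y)),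
       ascale = (\<lambda>c X. \<Union>x \<in> X. ideal_coset A J (ascale A c x)) \<rparr>"

definition algebra_iso ::
    "('k, 'a) algebra_structure \<Rightarrow> ('k, 'b) algebra_structure \<Rightarrow> ('a \<Rightarrow> 'b) \<Rightarrow> bool" where
  "algebra_iso A B f \<longleftrightarrow>
     bij_betw f (acarrier A) (acarrier B) \<and>
     (\<forall>x \<in> acarrier A. \<forall>y \<in> acarrier A. f (aadd A x y) = aadd B (f x) (f y)) \<and>
     (\<forall>x \<in> acarrier A. \<forall>y \<in> acarrier A. f (amult A x y) = amult B (f x) (f y)) \<and>
     (\<forall>c. \<forall>x \<in> acarrier A. f (ascale A c x) = ascale B c (f x))"

definition algebra_isomorphic ::
    "('k, 'a) algebra_structure \<Rightarrow> ('k, 'b) algebra_structure \<Rightarrow> bool" where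
  "algebra_isomorphic A B \<longleftrightarrow> (\<exists>f. algebra_iso A B f)"

context nonunital_algebra
begin

context
  fixes J assumes J: "two_sided_ideal A J"
begin

lemma ideal_in_carrier: "x \<in> J \<Longrightarrow> x \<in> acarrier A"
  using J by (auto simp: two_sided_ideal_def)

lemma ideal_coset_absorb:
  assumes a: "a \<in> acarrier A" and x: "x \<in> J"
  shows "ideal_coset A J (aadd A a x) = ideal_coset A J a"
proof -
  have "aadd A (aadd A a x) ` J \<subseteq> aadd A a ` J"
  proof safe
    fix y assume y: "y \<in> J"
    have "aadd A (aadd A a x) y = aadd A a (aadd A x y)" "aadd A x y \<in> J"
      using a x y J ideal_in_carrier by (auto simp: add_assoc two_sided_ideal_def)
    then show "aadd A (aadd A a x) y \<in> aadd A a ` J" by blast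
  qed
  moreover have "aadd A a ` J \<subseteq> aadd A (aadd A a x) ` J"
  proof safe
    fix y assume y: "y \<in> J"
    let ?z = "aadd A (ascale A (- 1) x) y"
    have nx: "ascale A (- 1) x \<in> J" and z: "?z \<in> J" using x y J by (auto simp: two_sided_ideal_def)
    have "aadd A (aadd A a x) ?z = aadd A a (aadd A (aadd A x (ascale A (- 1) x)) y)"
      using a x y z nx by (simp add: add_assoc ideal_in_carrier add_closed)
    also have "\<dots> = aadd A a y"
      using a x y by (simp add: add_inverse add_zero ideal_in_carrier)
    finally show "aadd A a y \<in> aadd A (aadd A a x) ` J" using z by (metis image_eqI)
  qed
  ultimately show ?thesis by (auto simp: ideal_coset_def)
qed

lemma ideal_coset_self: "a \<in> acarrier A \<Longrightarrow> a \<in> ideal_coset A J a"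
proof -
  assume a: "a \<in> acarrier A"
  then have "aadd A a (azero A) = a" by (metis add_commute add_zero zero_closed)
  then show ?thesis using J by (force simp: ideal_coset_def two_sided_ideal_def)
qed

lemma ideal_coset_Union:
  assumes "a \<in> acarrier A" and "\<And>x. x \<in> J \<Longrightarrow> F (aadd A a x) = F a"
  shows "(\<Union>x \<in> ideal_coset A J a. F x) = F a"
  using assms J ideal_coset_self[OF assms(1)] unfolding ideal_coset_def by auto

lemma quotient_add:
  assumes a: "a \<in> acarrier A" and b: "b \<in> acarrier A"
  shows "aadd (quotient_algebra A J) (ideal_coset A J a) (ideal_coset A J b)
         = ideal_coset A J (aadd A a b)"
proof -
  have 1: "ideal_coset A J (aadd A x (aadd A b y)) = ideal_coset A J (aadd A x b)"
    if "x \<in> acarrier A" "y \<in> J" for x y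
    using that b ideal_coset_absorb[of "aadd A x b" y]
    by (simp add: add_assoc ideal_in_carrier add_closed)
  have 2: "(\<Union>y \<in> ideal_coset A J b. ideal_coset A J (aadd A x y)) = ideal_coset A J (aadd A x b)"
    if "x \<in> acarrier A" for x
    using that b by (intro ideal_coset_Union) (auto simp: 1)
  have 3: "ideal_coset A J (aadd A (aadd A a y) b) = ideal_coset A J (aadd A a b)" if "y \<in> J" for y
  proof -
    have "aadd A (aadd A a y) b = aadd A (aadd A a b) y"
      using a b that by (metis add_assoc add_commute ideal_in_carrier)
    then show ?thesis using that a b by (simp add: ideal_coset_absorb add_closed)
  qed
  show ?thesis unfolding quotient_algebra_def algebra_structure.simps
    by (subst ideal_coset_Union[OF a]) (use a b in \<open>auto simp: 2 3 ideal_in_carrier add_closed\<close>)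
qed

lemma quotient_mult:
  assumes a: "a \<in> acarrier A" and b: "b \<in> acarrier A"
  shows "amult (quotient_algebra A J) (ideal_coset A J a) (ideal_coset A J b)
         = ideal_coset A J (amult A a b)"
proof -
  have 1: "ideal_coset A J (amult A x (aadd A b y)) = ideal_coset A J (amult A x b)"
    if "x \<in> acarrier A" "y \<in> J" for x y
  proof -
    have "amult A x y \<in> J" using J that by (auto simp: two_sided_ideal_def)
    then show ?thesis using that b
      by (simp add: distrib_left ideal_in_carrier ideal_coset_absorb mult_closed)
  qed
  have 2: "(\<Union>y \<in> ideal_coset A J b. ideal_coset A J (amult A x y)) = ideal_coset A J (amult A x b)"
    if "x \<in> acarrier A" for x
    using that b by (intro ideal_coset_Union) (auto simp: 1)
  have 3: "ideal_coset A J (amult A (aadd A a y) b) = ideal_coset A J (amult A a b)" if "y \<in> J" for y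
  proof -
    have "amult A y b \<in> J" using J that b by (auto simp: two_sided_ideal_def)
    then show ?thesis using that a b
      by (simp add: distrib_right ideal_in_carrier ideal_coset_absorb mult_closed)
  qed
  show ?thesis unfolding quotient_algebra_def algebra_structure.simps
    by (subst ideal_coset_Union[OF a]) (use a b in \<open>auto simp: 2 3 ideal_in_carrier add_closed\<close>)
qed

lemma quotient_scale:
  assumes a: "a \<in> acarrier A"
  shows "ascale (quotient_algebra A J) c (ideal_coset A J a) = ideal_coset A J (ascale A c a)"
proof -
  have "ideal_coset A J (ascale A c (aadd A a y)) = ideal_coset A J (ascale A c a)" if "y \<in> J" for y
  proof -
    have "ascale A c y \<in> J" using J that by (auto simp: two_sided_ideal_def)
    then show ?thesis using that a
      by (simp add: scale_add ideal_in_carrier ideal_coset_absorb scale_closed)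
  qed
  then show ?thesis unfolding quotient_algebra_def algebra_structure.simps
    by (intro ideal_coset_Union[OF a])
qed

theorem nonunital_algebra_quotient: "nonunital_algebra (quotient_algebra A J)"
proof -
  let ?Q = "quotient_algebra A J"
  have car: "acarrier ?Q = ideal_coset A J ` acarrier A"
    and zer: "azero ?Q = ideal_coset A J (azero A)"
    by (auto simp: quotient_algebra_def)
  note closed = zero_closed add_closed mult_closed scale_closed
  note ops = quotient_add quotient_mult quotient_scale
  show ?thesis
    by unfold_locales
      (auto simp: car zer ops closed add_assoc add_zero add_inverse mult_assoc distrib_left
         distrib_right scale_add add_scale scale_scale scale_one scale_mult_left scale_mult_right
         intro!: imageI, auto simp: add_commute)
qed

end

end


section \<open>Free algebras and presentations\<close>

text \<open>Words form a monoid under concatenation, so that \<open>'x list \<Rightarrow>\<^sub>0 'k\<close> with its convolution product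
  is the free unital algebra on \<open>'x\<close>.\<close>

instantiation list :: (type) monoid_add
begin

definition zero_list :: "'a list" where "zero_list = []"
definition plus_list :: "'a list \<Rightarrow> 'a list \<Rightarrow> 'a list" where "plus_list = (@)"

instance by standard (auto simp: zero_list_def plus_list_def)

end

text \<open>Excluding the empty word gives the free algebra without unit on a set \<open>X\<close>.\<close>

definition free_algebra :: "'x set \<Rightarrow> ('k::field, 'x list \<Rightarrow>\<^sub>0 'k) algebra_structure" where
  "free_algebra X =
     \<lparr> acarrier = {f. Poly_Mapping.keys f \<subseteq> {w. w \<noteq> [] \<and> set w \<subseteq> X}},
       azero = 0,
       aadd = (+),
       amult = (*),
       ascale = (\<lambda>c. Poly_Mapping.map ((*) c)) \<rparr>"

definition free_gen :: "'x \<Rightarrow> ('x list \<Rightarrow>\<^sub>0 'k::field)" where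
  "free_gen x = Poly_Mapping.single [x] 1"

text \<open>The universal algebra with generators \<open>X\<close> in which all elements of \<open>R\<close> vanish.\<close>

definition presented_ideal :: "'x set \<Rightarrow> ('x list \<Rightarrow>\<^sub>0 'k::field) set \<Rightarrow> ('x list \<Rightarrow>\<^sub>0 'k) set" where
  "presented_ideal X R = two_sided_ideal (free_algebra X) hull R"

definition presented_algebra ::
    "'x set \<Rightarrow> ('x list \<Rightarrow>\<^sub>0 'k::field) set \<Rightarrow> ('k, ('x list \<Rightarrow>\<^sub>0 'k) set) algebra_structure" where
  "presented_algebra X R = quotient_algebra (free_algebra X) (presented_ideal X R)"

definition presented_gen ::
    "'x set \<Rightarrow> ('x list \<Rightarrow>\<^sub>0 'k::field) set \<Rightarrow> 'x \<Rightarrow> ('x list \<Rightarrow>\<^sub>0 'k) set" where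
  "presented_gen X R x = ideal_coset (free_algebra X) (presented_ideal X R) (free_gen x)"

lemma free_algebra_simps:
  "azero (free_algebra X) = 0"
  "aadd (free_algebra X) = (+)"
  "amult (free_algebra X) = (*)"
  "ascale (free_algebra X) c = Poly_Mapping.map ((*) c)"
  by (auto simp: free_algebra_def)

lemma map_times_eq: "Poly_Mapping.map ((*) c) f = Poly_Mapping.single [] c * f"
  for f :: "'x list \<Rightarrow>\<^sub>0 'k::field"
proof -
  have "Poly_Mapping.single 0 c * f = Poly_Mapping.map ((*) c) f"
    by (rule mult_map_scale_conv_mult[symmetric])
  then show ?thesis by (simp add: zero_list_def)
qed

lemma single_Nil_commute: "f * Poly_Mapping.single [] c = Poly_Mapping.single [] c * f"
  for f :: "'x list \<Rightarrow>\<^sub>0 'k::field"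
proof (induction f rule: update_induct)
  case const
  then show ?case by simp
next
  case (update f a b)
  have "Poly_Mapping.update a b f = Poly_Mapping.single a b + f"
    using update(1) by (intro poly_mapping_eqI)
      (auto simp: lookup_update lookup_add lookup_single when_def in_keys_iff)
  then show ?case using update(3)
    by (simp add: algebra_simps mult_single zero_list_def[symmetric])
qed

theorem nonunital_algebra_free_algebra:
  "nonunital_algebra (free_algebra X :: ('k::field, 'x list \<Rightarrow>\<^sub>0 'k) algebra_structure)"
proof -
  let ?A = "free_algebra X :: ('k, 'x list \<Rightarrow>\<^sub>0 'k) algebra_structure"
  have car: "f \<in> acarrier ?A \<longleftrightarrow> (\<forall>w \<in> Poly_Mapping.keys f. w \<noteq> [] \<and> set w \<subseteq> X)" for f
    by (auto simp: free_algebra_def)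
  have add: "f + g \<in> acarrier ?A" if "f \<in> acarrier ?A" "g \<in> acarrier ?A" for f g
    using that keys_add[of f g] unfolding car by blast
  have mult: "f * g \<in> acarrier ?A" if "f \<in> acarrier ?A" "g \<in> acarrier ?A" for f g
    using that keys_mult[of f g] unfolding car plus_list_def by fastforce
  have scale: "Poly_Mapping.single [] c * f \<in> acarrier ?A" if "f \<in> acarrier ?A" for c f
    using that keys_mult[of "Poly_Mapping.single [] c" f] unfolding car
    by (force simp: plus_list_def split: if_splits)
  have one: "Poly_Mapping.single [] 1 = (1 :: 'x list \<Rightarrow>\<^sub>0 'k)"
    by (simp add: zero_list_def[symmetric] single_one)
  have inv: "f + Poly_Mapping.single [] (- 1) * f = 0" for f :: "'x list \<Rightarrow>\<^sub>0 'k"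
    by (simp add: single_uminus one)
  have scale_scale: "Poly_Mapping.single [] c * (Poly_Mapping.single [] d * f)
      = Poly_Mapping.single [] (c * d) * f" for c d and f :: "'x list \<Rightarrow>\<^sub>0 'k"
    by (simp add: mult.assoc[symmetric] mult_single plus_list_def)
  have mult_scale: "f * (Poly_Mapping.single [] c * g) = Poly_Mapping.single [] c * (f * g)"
    for c and f g :: "'x list \<Rightarrow>\<^sub>0 'k"
    by (metis mult.assoc single_Nil_commute)
  have zero: "0 \<in> acarrier ?A"
    by (simp add: car)
  show ?thesis
    unfolding nonunital_algebra_def free_algebra_simps map_times_eq
    apply (intro conjI allI impI)
    subgoal by (rule zero)
    subgoal by (rule add)
    subgoal by (rule mult)
    subgoal by (rule scale)
    subgoal by (rule add.assoc)
    subgoal by (rule add.commute)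
    subgoal by (rule add_0)
    subgoal by (rule inv)
    subgoal by (rule mult.assoc)
    subgoal by (rule distrib_left)
    subgoal by (rule distrib_right)
    subgoal by (rule distrib_left)
    subgoal by (simp only: single_add distrib_right)
    subgoal by (rule scale_scale)
    subgoal by (simp only: one mult_1_left)
    subgoal by (rule mult.assoc)
    subgoal by (rule mult_scale)
    done
qed

lemma two_sided_ideal_presented_ideal:
  assumes R: "R \<subseteq> acarrier (free_algebra X)"
  shows "two_sided_ideal (free_algebra X) (presented_ideal X R)"
proof -
  interpret nonunital_algebra "free_algebra X" by (rule nonunital_algebra_free_algebra)
  have "two_sided_ideal (free_algebra X) (acarrier (free_algebra X))"
    by (auto simp: two_sided_ideal_def zero_closed add_closed mult_closed scale_closed)
  then have "presented_ideal X R \<subseteq> acarrier (free_algebra X)"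
    using R unfolding presented_ideal_def by (rule hull_minimal[rotated])
  then show ?thesis
    unfolding two_sided_ideal_def presented_ideal_def hull_def by simp
qed

lemma nonunital_algebra_presented_algebra:
  assumes "R \<subseteq> acarrier (free_algebra X)"
  shows "nonunital_algebra (presented_algebra X R)"
  unfolding presented_algebra_def
  by (intro nonunital_algebra.nonunital_algebra_quotient nonunital_algebra_free_algebra
      two_sided_ideal_presented_ideal assms)


section \<open>Leavitt path algebras\<close>

datatype ('v, 'e) lpa_gen = Vert 'v | Edge 'e | Ghost 'e

definition lpa_gens :: "('v, 'e) pre_digraph \<Rightarrow> ('v, 'e) lpa_gen set" where
  "lpa_gens E = Vert ` verts E \<union> Edge ` arcs E \<union> Ghost ` arcs E"

definition lpa_relations ::
    "('v, 'e) pre_digraph \<Rightarrow> (('v, 'e) lpa_gen list \<Rightarrow>\<^sub>0 'k::field) set" where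
  "lpa_relations E =
     {free_gen (Vert v) * free_gen (Vert w) - (if v = w then free_gen (Vert v) else 0) | v w.
        v \<in> verts E \<and> w \<in> verts E} \<union>
     {free_gen (Vert (tail E e)) * free_gen (Edge e) - free_gen (Edge e) | e. e \<in> arcs E} \<union>
     {free_gen (Edge e) * free_gen (Vert (head E e)) - free_gen (Edge e) | e. e \<in> arcs E} \<union>
     {free_gen (Vert (head E e)) * free_gen (Ghost e) - free_gen (Ghost e) | e. e \<in> arcs E} \<union>
     {free_gen (Ghost e) * free_gen (Vert (tail E e)) - free_gen (Ghost e) | e. e \<in> arcs E} \<union>
     {free_gen (Ghost e) * free_gen (Edge f) - (if e = f then free_gen (Vert (head E e)) else 0)
        | e f. e \<in> arcs E \<and> f \<in> arcs E} \<union>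
     {free_gen (Vert v) - (\<Sum>e \<in> out_arcs E v. free_gen (Edge e) * free_gen (Ghost e)) | v.
        v \<in> regular_verts E}"

definition leavitt_path_algebra ::
    "('v, 'e) pre_digraph \<Rightarrow> ('k::field, (('v, 'e) lpa_gen list \<Rightarrow>\<^sub>0 'k) set) algebra_structure" where
  "leavitt_path_algebra E = presented_algebra (lpa_gens E) (lpa_relations E)"

definition lpa_vertex ::
    "('v, 'e) pre_digraph \<Rightarrow> 'v \<Rightarrow> (('v, 'e) lpa_gen list \<Rightarrow>\<^sub>0 'k::field) set" where
  "lpa_vertex E v = presented_gen (lpa_gens E) (lpa_relations E) (Vert v)"

definition ideal_vertices ::
    "('v, 'e) pre_digraph \<Rightarrow> (('v, 'e) lpa_gen list \<Rightarrow>\<^sub>0 'k::field) set set \<Rightarrow> 'v set" where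
  "ideal_vertices E J = {v \<in> verts E. lpa_vertex E v \<in> J}"

context
  fixes E :: "('v, 'e) pre_digraph"
  assumes wf: "wf_digraph E"
begin

interpretation wf_digraph E by (rule wf)

lemma lpa_relations_in_carrier:
  "lpa_relations E \<subseteq>
     acarrier (free_algebra (lpa_gens E) :: ('k::field, _) algebra_structure)"
proof -
  let ?A = "free_algebra (lpa_gens E) :: ('k, _) algebra_structure"
  interpret A: nonunital_algebra ?A by (rule nonunital_algebra_free_algebra)
  have gen: "free_gen x \<in> acarrier ?A" if "x \<in> lpa_gens E" for x
    using that by (auto simp: free_algebra_def free_gen_def)
  have zero: "0 \<in> acarrier ?A"
    using A.zero_closed by (simp add: free_algebra_simps)
  have mult: "f * g \<in> acarrier ?A" if "f \<in> acarrier ?A" "g \<in> acarrier ?A" for f g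
    using A.mult_closed[OF that] by (simp add: free_algebra_simps)
  have add: "f + g \<in> acarrier ?A" if "f \<in> acarrier ?A" "g \<in> acarrier ?A" for f g
    using A.add_closed[OF that] by (simp add: free_algebra_simps)
  have diff: "f - g \<in> acarrier ?A" if "f \<in> acarrier ?A" "g \<in> acarrier ?A" for f g
    using that keys_diff[of f g] by (auto simp: free_algebra_def)
  have sum: "sum F S \<in> acarrier ?A" if "\<And>x. x \<in> S \<Longrightarrow> F x \<in> acarrier ?A" for F and S :: "'e set"
    using that by (induction S rule: infinite_finite_induct) (auto simp: zero add)
  have gens: "\<And>v. v \<in> verts E \<Longrightarrow> free_gen (Vert v) \<in> acarrier ?A"
    "\<And>e. e \<in> arcs E \<Longrightarrow> free_gen (Edge e) \<in> acarrier ?A"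
    "\<And>e. e \<in> arcs E \<Longrightarrow> free_gen (Ghost e) \<in> acarrier ?A"
    by (rule gen, simp add: lpa_gens_def)+
  show ?thesis
    unfolding lpa_relations_def
    by (intro Un_least subsetI; elim CollectE exE conjE; hypsubst)
      (auto intro!: diff mult sum gens zero simp: regular_verts_def)
qed

theorem nonunital_algebra_leavitt_path_algebra: "nonunital_algebra (leavitt_path_algebra E)"
  unfolding leavitt_path_algebra_def
  by (intro nonunital_algebra_presented_algebra lpa_relations_in_carrier)

theorem hereditary_ideal_vertices:
  fixes J :: "(('v, 'e) lpa_gen list \<Rightarrow>\<^sub>0 'k::field) set set"
  assumes J: "two_sided_ideal (leavitt_path_algebra E) J"
  shows "hereditary E (ideal_vertices E J)"
proof -
  let ?X = "lpa_gens E" and ?R = "lpa_relations E :: (_ \<Rightarrow>\<^sub>0 'k) set"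
  let ?A = "free_algebra ?X :: ('k, _) algebra_structure"
  let ?I = "presented_ideal ?X ?R" and ?L = "leavitt_path_algebra E :: ('k, _) algebra_structure"
  interpret A: nonunital_algebra ?A by (rule nonunital_algebra_free_algebra)
  note I = two_sided_ideal_presented_ideal[OF lpa_relations_in_carrier]
  have L: "?L = quotient_algebra ?A ?I"
    by (simp add: leavitt_path_algebra_def presented_algebra_def)
  have gen: "free_gen x \<in> acarrier ?A" if "x \<in> ?X" for x
    using that by (auto simp: free_algebra_def free_gen_def)
  have mult: "amult ?L (presented_gen ?X ?R x) (presented_gen ?X ?R y) = presented_gen ?X ?R z"
    if "x \<in> ?X" "y \<in> ?X" "z \<in> ?X" "free_gen x * free_gen y - free_gen z \<in> ?R" for x y z
  proof -
    have "free_gen x * free_gen y - free_gen z \<in> ?I"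
      using that(4) unfolding presented_ideal_def by (rule hull_inc)
    from A.ideal_coset_absorb[OF I gen[OF that(3)] this] show ?thesis
      using that by (simp add: L presented_gen_def A.quotient_mult[OF I] gen free_algebra_simps)
  qed
  have car: "presented_gen ?X ?R x \<in> acarrier ?L" if "x \<in> ?X" for x
    using gen[OF that] by (auto simp: L quotient_algebra_def presented_gen_def)
  have edge: "head E e \<in> ideal_vertices E J" if e: "e \<in> arcs E" "tail E e \<in> ideal_vertices E J" for e
  proof -
    have gens: "Vert (tail E e) \<in> ?X" "Vert (head E e) \<in> ?X" "Edge e \<in> ?X" "Ghost e \<in> ?X"
      using e by (auto simp: lpa_gens_def)
    have "free_gen (Vert (tail E e)) * free_gen (Edge e) - free_gen (Edge e) \<in> ?R"
      using e(1) unfolding lpa_relations_def by blast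
    then have "presented_gen ?X ?R (Edge e) \<in> J"
      using J e mult[OF gens(1,3,3)] car[OF gens(3)]
      by (metis (mono_tags, lifting) ideal_vertices_def lpa_vertex_def mem_Collect_eq two_sided_ideal_def)
    moreover have "free_gen (Ghost e) * free_gen (Edge e) - free_gen (Vert (head E e)) \<in> ?R"
      using e(1) unfolding lpa_relations_def by (force intro!: exI[of _ e])
    ultimately have "presented_gen ?X ?R (Vert (head E e)) \<in> J"
      using J mult[OF gens(4,3,2)] car[OF gens(4)] by (metis two_sided_ideal_def)
    then show ?thesis using e by (simp add: ideal_vertices_def lpa_vertex_def)
  qed
  have "v \<in> ideal_vertices E J" if "awalk u p v" "u \<in> ideal_vertices E J" for u p v
    using that by (induction p arbitrary: u) (auto simp: awalk_simps edge)
  then show ?thesis by (auto simp: hereditary_def ideal_vertices_def)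
qed

end

end

theory Submission
  imports Defs
begin

text \<open>
  Let \<open>F = E/H(J)\<close>. Its generators are generators of \<open>E\<close>, so both algebras are quotients of
  word algebras one of which contains the other. Edges with range in \<open>H(J)\<close> lie in \<open>J\<close>, hence
  \<open>e \<mapsto> e + J\<close> defines a surjection \<open>L(F) \<rightarrow> L(E)/J\<close> that kills no vertex. It is injective by the
  Cuntz--Krieger uniqueness theorem: under Condition (L) every nonzero \<open>x\<close> satisfies
  \<open>a x b = v\<close> for some \<open>a\<close>, \<open>b\<close> and some vertex \<open>v\<close>. To see this, multiply \<open>x\<close> by a path to remove
  the ghost edges, take a shortest path \<open>\<alpha>\<close> occurring in the result, and compress by \<open>\<alpha>\<gamma>\<close> and \<open>\<gamma>\<close>,
  where \<open>\<gamma>\<close> leaves, through exits, each of the finitely many closed paths involved.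

  If a cycle of \<open>F\<close> at \<open>v\<close> had no exit in \<open>F\<close>, then \<open>v \<notin> J = J\<^sup>\<bottom>\<^sup>\<bottom>\<close> yields a nonzero \<open>v x\<close> or
  \<open>x v\<close> with \<open>x \<in> J\<^sup>\<bottom>\<close>, and reducing it to a vertex shows that some descendant of \<open>v\<close> lies in
  \<open>J\<^sup>\<bottom>\<close>. Such a descendant is in \<open>H(J)\<close> or on the cycle; in the latter case the range of an exit
  in \<open>E\<close> is in \<open>J \<inter> J\<^sup>\<bottom>\<close> too. But no vertex is in \<open>J \<inter> J\<^sup>\<bottom>\<close>, because vertices are nonzero idempotents.
\<close>

section \<open>Ideals of the free unital algebra\<close>

text \<open>Factors range over the whole unital ring; in the word algebra this includes the
  constants, so closure under scalars is automatic.\<close>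

definition ring_ideal :: "'r::ring_1 set \<Rightarrow> bool" where
  "ring_ideal I \<longleftrightarrow> 0 \<in> I \<and> (\<forall>x\<in>I. \<forall>y\<in>I. x + y \<in> I) \<and> (\<forall>r. \<forall>x\<in>I. r * x \<in> I \<and> x * r \<in> I)"

definition word_poly :: "'x list \<Rightarrow> ('x list \<Rightarrow>\<^sub>0 'k::field)" where
  "word_poly w = Poly_Mapping.single w 1"

abbreviation const_poly :: "'k::field \<Rightarrow> ('x list \<Rightarrow>\<^sub>0 'k)" where
  "const_poly c \<equiv> Poly_Mapping.single [] c"

lemma word_poly_Nil: "word_poly [] = 1"
  by (simp add: word_poly_def flip: zero_list_def)

lemma word_poly_append: "word_poly (u @ w) = word_poly u * word_poly w"
  by (simp add: word_poly_def mult_single plus_list_def)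

lemma free_gen_eq_word_poly: "free_gen x = word_poly [x]"
  by (simp add: free_gen_def word_poly_def)

lemma word_poly_Cons: "word_poly (x # w) = free_gen x * word_poly w"
  by (simp add: free_gen_eq_word_poly flip: word_poly_append)

lemma word_poly_snoc: "word_poly (w @ [x]) = word_poly w * free_gen x"
  by (simp add: free_gen_eq_word_poly word_poly_append)

lemma single_eq_const_poly_times: "Poly_Mapping.single w c = const_poly c * word_poly w"
  by (simp add: word_poly_def mult_single plus_list_def)

lemma const_poly_mult: "const_poly c * const_poly d = const_poly (c * d)"
  by (simp add: mult_single plus_list_def)

lemma const_poly_one: "const_poly 1 = 1"
  by (simp flip: zero_list_def)

lemma const_poly_left_commute: "x * (const_poly c * y) = const_poly c * (x * y)"
  by (metis mult.assoc single_Nil_commute)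

lemma poly_eq_sum_words:
  "f = (\<Sum>w\<in>Poly_Mapping.keys f. const_poly (Poly_Mapping.lookup f w) * word_poly w)"
proof (rule poly_mapping_eqI)
  fix k
  have "(\<Sum>w\<in>Poly_Mapping.keys f.
          Poly_Mapping.lookup (Poly_Mapping.single w (Poly_Mapping.lookup f w)) k)
      = (if k \<in> Poly_Mapping.keys f then Poly_Mapping.lookup f k else 0)"
    by (simp add: lookup_single when_def)
  then show "Poly_Mapping.lookup f k = Poly_Mapping.lookup
      (\<Sum>w\<in>Poly_Mapping.keys f. const_poly (Poly_Mapping.lookup f w) * word_poly w) k"
    by (auto simp: lookup_sum in_keys_iff simp flip: single_eq_const_poly_times)
qed

text \<open>A polynomial is the finite sum of its monomials, so additive properties need only be
  checked on scaled words. Taking \<open>W\<close> to be the nonempty words expresses the absence of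
  a constant term.\<close>

lemma poly_word_induct [consumes 1, case_names zero add word]:
  fixes f :: "'x list \<Rightarrow>\<^sub>0 'k::field"
  assumes "Poly_Mapping.keys f \<subseteq> W"
    and "P 0" and "\<And>f g. P f \<Longrightarrow> P g \<Longrightarrow> P (f + g)"
    and "\<And>c w. w \<in> W \<Longrightarrow> P (const_poly c * word_poly w)"
  shows "P f"
proof -
  have "P (\<Sum>w\<in>S. const_poly (Poly_Mapping.lookup f w) * word_poly w)" if "finite S" "S \<subseteq> W" for S
    using that by (induction S rule: finite_induct) (auto intro: assms)
  from this[OF finite_keys assms(1)] show ?thesis by (simp flip: poly_eq_sum_words)
qed

lemma nonconstant_mult:
  fixes f g :: "'x list \<Rightarrow>\<^sub>0 'k::field"
  assumes "[] \<notin> Poly_Mapping.keys f"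
  shows "[] \<notin> Poly_Mapping.keys (f * g)" "[] \<notin> Poly_Mapping.keys (g * f)"
  using assms keys_mult[of f g] keys_mult[of g f] by (auto simp: plus_list_def)

section \<open>Closure rules for ideals of a unital ring\<close>

context
  fixes I :: "'r::ring_1 set" assumes I: "ring_ideal I"
begin

lemma ring_ideal_zero: "0 \<in> I"
  and ring_ideal_add: "x \<in> I \<Longrightarrow> y \<in> I \<Longrightarrow> x + y \<in> I"
  and ring_ideal_mult_left: "x \<in> I \<Longrightarrow> r * x \<in> I"
  and ring_ideal_mult_right: "x \<in> I \<Longrightarrow> x * r \<in> I"
  using I by (auto simp: ring_ideal_def)

lemma ring_ideal_uminus: "x \<in> I \<Longrightarrow> - x \<in> I"
  using ring_ideal_mult_left[of x "- 1"] by simp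

lemma ring_ideal_diff: "x \<in> I \<Longrightarrow> y \<in> I \<Longrightarrow> x - y \<in> I"
  using ring_ideal_add[of x "- y"] ring_ideal_uminus by simp

lemma ring_ideal_sum: "(\<And>a. a \<in> S \<Longrightarrow> F a \<in> I) \<Longrightarrow> sum F S \<in> I"
  by (induction S rule: infinite_finite_induct) (auto intro: ring_ideal_zero ring_ideal_add)

lemma ring_ideal_cong: "x - y \<in> I \<Longrightarrow> x \<in> I \<longleftrightarrow> y \<in> I"
  using ring_ideal_add[of "x - y" y] ring_ideal_diff[of x "x - y"] by auto

end

subsection \<open>Extending ideals by the foreign letters\<close>

lemma carrier_free_algebra:
  "f \<in> acarrier (free_algebra X) \<longleftrightarrow>
     [] \<notin> Poly_Mapping.keys f \<and> (\<forall>w\<in>Poly_Mapping.keys f. set w \<subseteq> X)"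
  by (auto simp: free_algebra_def)

text \<open>This is the ideal generated by the letters outside \<open>X\<close>, described through
  its monomials.\<close>

definition foreign :: "'x set \<Rightarrow> ('x list \<Rightarrow>\<^sub>0 'k::field) set" where
  "foreign X = {f. \<forall>w\<in>Poly_Mapping.keys f. \<not> set w \<subseteq> X}"

text \<open>An ideal of the non-unital algebra on \<open>X\<close> becomes an ideal of the whole word algebra once the
  letters outside \<open>X\<close> are set to zero; no membership conditions are then needed for the factors.\<close>

definition extend_ideal :: "'x set \<Rightarrow> ('x list \<Rightarrow>\<^sub>0 'k::field) set \<Rightarrow> ('x list \<Rightarrow>\<^sub>0 'k) set" where
  "extend_ideal X J = {f. \<exists>a\<in>J. f - a \<in> foreign X}"

lemma ring_ideal_foreign: "ring_ideal (foreign X :: ('x list \<Rightarrow>\<^sub>0 'k::field) set)"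
proof -
  have "r * f \<in> foreign X" "f * r \<in> foreign X" if f: "f \<in> foreign X" for r f :: "'x list \<Rightarrow>\<^sub>0 'k"
  proof -
    have "\<not> set w \<subseteq> X" if w: "w \<in> Poly_Mapping.keys (r * f) \<union> Poly_Mapping.keys (f * r)" for w
    proof -
      obtain a b where "w = a @ b \<or> w = b @ a" "b \<in> Poly_Mapping.keys f"
        using w keys_mult[of r f] keys_mult[of f r] unfolding plus_list_def by blast
      then show ?thesis using f by (auto simp: foreign_def)
    qed
    then show "r * f \<in> foreign X" "f * r \<in> foreign X" by (auto simp: foreign_def)
  qed
  moreover have "f + g \<in> foreign X" if "f \<in> foreign X" "g \<in> foreign X" for f g :: "'x list \<Rightarrow>\<^sub>0 'k"
    using that subsetD[OF keys_add[of f g]] by (auto simp: foreign_def)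
  moreover have "0 \<in> foreign X" by (simp add: foreign_def)
  ultimately show ?thesis unfolding ring_ideal_def by blast
qed

text \<open>The monomials are sorted by whether all their letters lie in \<open>X\<close>. The last
  property ensures that \<open>g\<close> has no constant term when \<open>f\<close> has
  none.\<close>

lemma foreign_decomposition:
  fixes f :: "'x list \<Rightarrow>\<^sub>0 'k::field"
  obtains g where "f - g \<in> foreign X" "\<And>w. w \<in> Poly_Mapping.keys g \<Longrightarrow> set w \<subseteq> X"
    "Poly_Mapping.keys g \<subseteq> Poly_Mapping.keys f"
proof -
  let ?t = "\<lambda>w. const_poly (Poly_Mapping.lookup f w) * word_poly w"
  let ?S = "{w \<in> Poly_Mapping.keys f. set w \<subseteq> X}"
  let ?T = "{w \<in> Poly_Mapping.keys f. \<not> set w \<subseteq> X}"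
  have kt: "Poly_Mapping.keys (?t w) \<subseteq> {w}" for w
    by (simp flip: single_eq_const_poly_times)
  have "f = sum ?t (?S \<union> ?T)"
    by (subst poly_eq_sum_words) (rule sum.cong, auto)
  also have "\<dots> = sum ?t ?S + sum ?t ?T"
    by (rule sum.union_disjoint) auto
  finally have "f - sum ?t ?S = sum ?t ?T" by (simp add: algebra_simps)
  moreover have "sum ?t ?T \<in> foreign X"
  proof (rule ring_ideal_sum[OF ring_ideal_foreign])
    show "?t w \<in> foreign X" if "w \<in> ?T" for w
      using that subsetD[OF kt[of w]] by (auto simp: foreign_def)
  qed
  moreover have "Poly_Mapping.keys (sum ?t ?S) \<subseteq> ?S"
    using keys_sum[of ?t ?S] kt by fast
  ultimately show ?thesis by (intro that[of "sum ?t ?S"]) auto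
qed

lemma foreign_inter_carrier: "f \<in> foreign X \<Longrightarrow> f \<in> acarrier (free_algebra X) \<Longrightarrow> f = 0"
  unfolding carrier_free_algebra foreign_def mem_Collect_eq
  by (metis all_not_in_conv keys_eq_empty)

context
  fixes X :: "'x set" and J :: "('x list \<Rightarrow>\<^sub>0 'k::field) set"
  assumes J: "two_sided_ideal (free_algebra X) J"
begin

lemma free_ideal_props:
  shows "x \<in> J \<Longrightarrow> x \<in> acarrier (free_algebra X)" and "0 \<in> J"
    and "x \<in> J \<Longrightarrow> y \<in> J \<Longrightarrow> x + y \<in> J" and "x \<in> J \<Longrightarrow> const_poly c * x \<in> J"
    and "x \<in> J \<Longrightarrow> a \<in> acarrier (free_algebra X) \<Longrightarrow> a * x \<in> J \<and> x * a \<in> J"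
  using J by (auto simp: two_sided_ideal_def free_algebra_simps map_times_eq)

text \<open>The ideal axioms only speak of factors without constant term. Working by monomials
  removes this restriction, since the empty word acts as the identity.\<close>

lemma free_ideal_mult:
  assumes "x \<in> J" and r: "\<And>w. w \<in> Poly_Mapping.keys r \<Longrightarrow> set w \<subseteq> X"
  shows "r * x \<in> J \<and> x * r \<in> J"
proof -
  have "Poly_Mapping.keys r \<subseteq> {w. set w \<subseteq> X}" using r by blast
  then show ?thesis
  proof (induction r rule: poly_word_induct)
    case (word c w)
    have "word_poly w * x \<in> J \<and> x * word_poly w \<in> J"
    proof (cases "w = []")
      case False
      then have "word_poly w \<in> acarrier (free_algebra X)"
        using word by (simp add: carrier_free_algebra word_poly_def)
      then show ?thesis using free_ideal_props(5) \<open>x \<in> J\<close> by blast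
    qed (use \<open>x \<in> J\<close> in \<open>simp add: word_poly_Nil\<close>)
    then have "const_poly c * (word_poly w * x) \<in> J" "const_poly c * (x * word_poly w) \<in> J"
      by (auto intro: free_ideal_props(4))
    moreover have "const_poly c * (x * word_poly w) = x * (const_poly c * word_poly w)"
      by (simp only: mult.assoc single_Nil_commute[of x c] flip: mult.assoc)
    ultimately show ?case by (simp add: mult.assoc)
  qed (auto simp: algebra_simps intro: free_ideal_props)
qed

lemma subset_extend_ideal: "J \<subseteq> extend_ideal X J"
  unfolding extend_ideal_def using ring_ideal_zero[OF ring_ideal_foreign] by force

lemma foreign_subset_extend_ideal: "foreign X \<subseteq> extend_ideal X J"
  unfolding extend_ideal_def using free_ideal_props(2) by force

text \<open>The difference between \<open>f\<close> and its witness in \<open>J\<close> is foreign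
  and yet written in the letters of \<open>X\<close>, hence zero. So extending an ideal adds nothing
  inside the non-unital algebra.\<close>

lemma extend_ideal_inter_carrier:
  assumes "f \<in> extend_ideal X J" "f \<in> acarrier (free_algebra X)"
  shows "f \<in> J"
proof -
  obtain a where a: "a \<in> J" "f - a \<in> foreign X"
    using assms by (auto simp: extend_ideal_def)
  have "f - a \<in> acarrier (free_algebra X)"
    using assms(2) free_ideal_props(1)[OF a(1)] subsetD[OF keys_diff[of f a]]
    unfolding carrier_free_algebra by blast
  then have "f - a = 0" using a foreign_inter_carrier by blast
  then show ?thesis using a by simp
qed

text \<open>In a product, \<open>r\<close> may be replaced by its part \<open>r'\<close> in the
  letters of \<open>X\<close>, and \<open>f\<close> by its witness \<open>a\<close> in
  \<open>J\<close>: the errors are foreign, and \<open>r' * a\<close> and \<open>a * r'\<close> stay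
  in \<open>J\<close>.\<close>

lemma ring_ideal_extend_ideal: "ring_ideal (extend_ideal X J)"
proof -
  note F = ring_ideal_foreign[of X]
  have "r * f \<in> extend_ideal X J \<and> f * r \<in> extend_ideal X J" if f: "f \<in> extend_ideal X J" for r f
  proof -
    obtain a where a: "a \<in> J" "f - a \<in> foreign X"
      using f by (auto simp: extend_ideal_def)
    obtain r' where r': "r - r' \<in> foreign X" "\<And>w. w \<in> Poly_Mapping.keys r' \<Longrightarrow> set w \<subseteq> X"
      by (rule foreign_decomposition[of r X]) blast
    have 1: "r' * a \<in> J" "a * r' \<in> J"
      using free_ideal_mult[OF a(1) r'(2)] by auto
    have "r * f - r' * a = r * (f - a) + (r - r') * a"
      "f * r - a * r' = (f - a) * r + a * (r - r')" by (simp_all add: algebra_simps)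
    moreover have "r * (f - a) + (r - r') * a \<in> foreign X" "(f - a) * r + a * (r - r') \<in> foreign X"
      using a r' by (blast intro: ring_ideal_add[OF F] ring_ideal_mult_left[OF F] ring_ideal_mult_right[OF F])+
    ultimately have 2: "r * f - r' * a \<in> foreign X" "f * r - a * r' \<in> foreign X" by simp_all
    show ?thesis unfolding extend_ideal_def using 1 2 by blast
  qed
  moreover have "f + g \<in> extend_ideal X J" if fg: "f \<in> extend_ideal X J" "g \<in> extend_ideal X J" for f g
  proof -
    obtain a b where ab: "a \<in> J" "f - a \<in> foreign X" "b \<in> J" "g - b \<in> foreign X"
      using fg by (auto simp: extend_ideal_def)
    have "f + g - (a + b) = (f - a) + (g - b)" by simp
    then have "f + g - (a + b) \<in> foreign X" using ab ring_ideal_add[OF F] by metis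
    then show ?thesis using ab free_ideal_props(3) unfolding extend_ideal_def by blast
  qed
  moreover have "0 \<in> extend_ideal X J"
    using free_ideal_props(2) subset_extend_ideal by blast
  ultimately show ?thesis unfolding ring_ideal_def by blast
qed

lemma foreign_letter_in_extend_ideal: "x \<notin> X \<Longrightarrow> free_gen x \<in> extend_ideal X J"
  using foreign_subset_extend_ideal by (auto simp: foreign_def free_gen_def)

end

section \<open>Computing modulo the Leavitt relations\<close>

text \<open>The ideal is a parameter because the same calculus is needed modulo zero and modulo
  \<open>J\<close> in \<open>L(E)\<close>, and again for the quotient graph. Since foreign letters
  vanish, most rules below hold for every letter, whether or not it belongs to
  \<open>E\<close>.\<close>

locale lpa_ideal = wf_digraph E for E :: "('v, 'e) pre_digraph" +
  fixes I :: "(('v, 'e) lpa_gen list \<Rightarrow>\<^sub>0 'k::field) set"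
  assumes ideal: "ring_ideal I"
    and relations: "lpa_relations E \<subseteq> I"
    and foreign_letters: "x \<notin> lpa_gens E \<Longrightarrow> free_gen x \<in> I"
begin

lemmas I_zero = ring_ideal_zero[OF ideal]
  and I_add = ring_ideal_add[OF ideal]
  and I_mult_left = ring_ideal_mult_left[OF ideal]
  and I_mult_right = ring_ideal_mult_right[OF ideal]
  and I_uminus = ring_ideal_uminus[OF ideal]
  and I_diff = ring_ideal_diff[OF ideal]
  and I_sum = ring_ideal_sum[OF ideal]

abbreviation V :: "'v \<Rightarrow> (('v, 'e) lpa_gen list \<Rightarrow>\<^sub>0 'k)" where "V v \<equiv> free_gen (Vert v)"
abbreviation Ed :: "'e \<Rightarrow> (('v, 'e) lpa_gen list \<Rightarrow>\<^sub>0 'k)" where "Ed e \<equiv> free_gen (Edge e)"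
abbreviation Gh :: "'e \<Rightarrow> (('v, 'e) lpa_gen list \<Rightarrow>\<^sub>0 'k)" where "Gh e \<equiv> free_gen (Ghost e)"

definition cong :: "(('v, 'e) lpa_gen list \<Rightarrow>\<^sub>0 'k) \<Rightarrow> (('v, 'e) lpa_gen list \<Rightarrow>\<^sub>0 'k) \<Rightarrow> bool"
    (infix "\<approx>" 50) where
  "x \<approx> y \<longleftrightarrow> x - y \<in> I"

lemma cong_refl [simp]: "x \<approx> x"
  by (simp add: cong_def I_zero)

lemma cong_sym: "x \<approx> y \<Longrightarrow> y \<approx> x"
  using I_uminus[of "x - y"] by (simp add: cong_def)

lemma cong_trans [trans]: "x \<approx> y \<Longrightarrow> y \<approx> z \<Longrightarrow> x \<approx> z"
  using I_add[of "x - y" "y - z"] by (simp add: cong_def)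

lemma cong_add: "x \<approx> y \<Longrightarrow> x' \<approx> y' \<Longrightarrow> x + x' \<approx> y + y'"
  using I_add[of "x - y" "x' - y'"] by (simp add: cong_def algebra_simps)

lemma cong_mult_left: "x \<approx> y \<Longrightarrow> a * x \<approx> a * y"
  using I_mult_left[of "x - y" a] by (simp add: cong_def algebra_simps)

lemma cong_mult_right: "x \<approx> y \<Longrightarrow> x * a \<approx> y * a"
  using I_mult_right[of "x - y" a] by (simp add: cong_def algebra_simps)

lemma cong_mult: "x \<approx> y \<Longrightarrow> x' \<approx> y' \<Longrightarrow> x * x' \<approx> y * y'"
  by (metis cong_mult_left cong_mult_right cong_trans)

lemma cong_in_I: "x \<approx> y \<Longrightarrow> x \<in> I \<longleftrightarrow> y \<in> I"
  unfolding cong_def by (rule ring_ideal_cong[OF ideal])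

lemma cong_zero: "x \<approx> 0 \<longleftrightarrow> x \<in> I"
  by (simp add: cong_def)

lemma in_I_cong: "x \<in> I \<Longrightarrow> y \<in> I \<Longrightarrow> x \<approx> y"
  by (simp add: cong_def I_diff)

lemma letter_cong:
  assumes "x \<notin> lpa_gens E" shows "a * free_gen x \<approx> free_gen x"
    "free_gen x * a \<approx> free_gen x"
  using foreign_letters[OF assms] by (auto intro: in_I_cong I_mult_left I_mult_right)

lemma V_idem: "V v * V v \<approx> V v"
proof (cases "v \<in> verts E")
  case True
  then have "V v * V v - (if v = v then V v else 0) \<in> lpa_relations E"
    unfolding lpa_relations_def by blast
  then show ?thesis using relations by (auto simp: cong_def)
qed (auto intro: letter_cong simp: lpa_gens_def image_iff)

lemma V_orth: "v \<noteq> w \<Longrightarrow> V v * V w \<in> I"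
proof (cases "v \<in> verts E \<and> w \<in> verts E")
  case True
  assume "v \<noteq> w"
  have "V v * V w - (if v = w then V v else 0) \<in> lpa_relations E"
    unfolding lpa_relations_def using True by blast
  then show ?thesis using relations \<open>v \<noteq> w\<close> by auto
next
  case False
  then have "V v \<in> I \<or> V w \<in> I" by (auto intro!: foreign_letters simp: lpa_gens_def image_iff)
  then show ?thesis by (auto intro: I_mult_left I_mult_right)
qed

lemma V_Ed: "V (tail E e) * Ed e \<approx> Ed e"
  and Ed_V: "Ed e * V (head E e) \<approx> Ed e"
  and V_Gh: "V (head E e) * Gh e \<approx> Gh e"
  and Gh_V: "Gh e * V (tail E e) \<approx> Gh e"
proof -
  have "V (tail E e) * Ed e \<approx> Ed e \<and> Ed e * V (head E e) \<approx> Ed e \<and>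
        V (head E e) * Gh e \<approx> Gh e \<and> Gh e * V (tail E e) \<approx> Gh e"
  proof (cases "e \<in> arcs E")
    case True
    then have "V (tail E e) * Ed e - Ed e \<in> lpa_relations E"
      "Ed e * V (head E e) - Ed e \<in> lpa_relations E"
      "V (head E e) * Gh e - Gh e \<in> lpa_relations E"
      "Gh e * V (tail E e) - Gh e \<in> lpa_relations E"
      unfolding lpa_relations_def by blast+
    then show ?thesis using relations by (auto simp: cong_def)
  qed (auto intro: letter_cong simp: lpa_gens_def image_iff)
  then show "V (tail E e) * Ed e \<approx> Ed e" "Ed e * V (head E e) \<approx> Ed e"
        "V (head E e) * Gh e \<approx> Gh e" "Gh e * V (tail E e) \<approx> Gh e" by auto
qed

lemma Gh_Ed_eq:
  assumes "e \<in> arcs E" shows "Gh e * Ed e \<approx> V (head E e)"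
proof -
  have "Gh e * Ed e - (if e = e then V (head E e) else 0) \<in> lpa_relations E"
    unfolding lpa_relations_def using assms by blast
  then show ?thesis using relations by (auto simp: cong_def)
qed

lemma Gh_Ed_neq: "e \<noteq> f \<Longrightarrow> Gh e * Ed f \<in> I"
proof (cases "e \<in> arcs E \<and> f \<in> arcs E")
  case True
  assume "e \<noteq> f"
  have "Gh e * Ed f - (if e = f then V (head E e) else 0) \<in> lpa_relations E"
    unfolding lpa_relations_def using True by blast
  then show ?thesis using relations \<open>e \<noteq> f\<close> by auto
next
  case False
  then have "Gh e \<in> I \<or> Ed f \<in> I" by (auto intro!: foreign_letters simp: lpa_gens_def image_iff)
  then show ?thesis by (auto intro: I_mult_left I_mult_right)
qed

lemma V_regular:
  assumes "v \<in> regular_verts E" shows "V v \<approx> (\<Sum>e\<in>out_arcs E v. Ed e * Gh e)"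
proof -
  have "V v - (\<Sum>e\<in>out_arcs E v. Ed e * Gh e) \<in> lpa_relations E"
    unfolding lpa_relations_def using assms by blast
  then show ?thesis using relations by (auto simp: cong_def)
qed

lemma V_foreign: "v \<notin> verts E \<Longrightarrow> V v \<in> I"
  by (auto intro!: foreign_letters simp: lpa_gens_def image_iff)

lemma orth_right:
  assumes "x * V v \<approx> x" "v \<noteq> w" shows "x * V w \<in> I"
proof -
  have "x * V w \<approx> x * V v * V w" by (rule cong_sym[OF cong_mult_right[OF assms(1)]])
  also have "x * V v * V w = x * (V v * V w)" by (simp add: mult.assoc)
  finally show ?thesis using V_orth[OF assms(2)] cong_in_I I_mult_left by metis
qed

lemma orth_left:
  assumes "V v * x \<approx> x" "w \<noteq> v" shows "V w * x \<in> I"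
proof -
  have "V w * x \<approx> V w * (V v * x)" by (rule cong_sym[OF cong_mult_left[OF assms(1)]])
  also have "V w * (V v * x) = V w * V v * x" by (simp add: mult.assoc)
  finally show ?thesis using V_orth[OF assms(2)] cong_in_I I_mult_right by metis
qed

lemma mult_orth:
  assumes "x * V v \<approx> x" "V w * y \<approx> y" "v \<noteq> w" shows "x * y \<in> I"
proof -
  have "x * y \<approx> x * V v * y" by (rule cong_sym[OF cong_mult_right[OF assms(1)]])
  also have "x * V v * y = x * (V v * y)" by (simp add: mult.assoc)
  finally show ?thesis using orth_left[OF assms(2,3)] cong_in_I I_mult_left by metis
qed

subsection \<open>Real and ghost paths\<close>

text \<open>The leading vertex letter makes even a trivial path a nonempty word, and lets the start
  and the edges be recovered from the word.\<close>

definition pe :: "'v \<Rightarrow> 'e list \<Rightarrow> (('v, 'e) lpa_gen list \<Rightarrow>\<^sub>0 'k)" where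
  "pe u p = word_poly (Vert u # map Edge p)"

lemma pe_Nil: "pe u [] = V u"
  by (simp add: pe_def free_gen_eq_word_poly)

lemma pe_append_word: "pe u (p @ q) = pe u p * word_poly (map Edge q)"
  by (simp add: pe_def flip: word_poly_append)

lemma pe_snoc: "pe u (p @ [e]) = pe u p * Ed e"
  by (simp add: pe_append_word free_gen_eq_word_poly)

lemma pe_eq: "pe u p = V u * word_poly (map Edge p)"
  using pe_append_word[of u "[]" p] by (simp add: pe_Nil)

lemma pe_V:
  assumes "awalk u p v" shows "pe u p * V v \<approx> pe u p"
proof (cases p rule: rev_cases)
  case Nil
  then show ?thesis using assms by (simp add: pe_Nil V_idem awalk_simps)
next
  case (snoc q e)
  then have "head E e = v" using assms by (auto simp: awalk_simps)
  then show ?thesis using cong_mult_left[OF Ed_V[of e], of "pe u q"] snoc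
    by (simp add: pe_snoc mult.assoc)
qed

lemma V_pe: "V u * pe u p \<approx> pe u p"
  using cong_mult_right[OF V_idem[of u], of "word_poly (map Edge p)"] by (simp add: pe_eq mult.assoc)

lemma pe_append: "awalk u p w \<Longrightarrow> pe u p * pe w q \<approx> pe u (p @ q)"
  using cong_mult_right[OF pe_V[of u p w], of "word_poly (map Edge q)"]
  by (simp add: pe_append_word pe_eq[of w] mult.assoc)

lemma pe_orth: "awalk u p v \<Longrightarrow> v \<noteq> w \<Longrightarrow> pe u p * pe w q \<in> I"
  by (rule mult_orth[OF pe_V V_pe])

lemma Ed_pe: "pe (tail E e) (e # p) \<approx> Ed e * pe (head E e) p"
proof -
  have "pe (tail E e) (e # p) = V (tail E e) * Ed e * word_poly (map Edge p)"
    by (simp add: pe_eq word_poly_Cons mult.assoc)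
  also have "\<dots> \<approx> Ed e * word_poly (map Edge p)"
    by (rule cong_mult_right[OF V_Ed])
  also have "\<dots> \<approx> Ed e * V (head E e) * word_poly (map Edge p)"
    by (rule cong_mult_right[OF cong_sym[OF Ed_V]])
  finally show ?thesis by (simp add: pe_eq mult.assoc)
qed

text \<open>This is the adjoint of the real path: its ghost edges come in reverse order, so that in
  a product with a real path the first edges of both meet in the middle.\<close>

fun ghost_path :: "'v \<Rightarrow> 'e list \<Rightarrow> (('v, 'e) lpa_gen list \<Rightarrow>\<^sub>0 'k)" where
  "ghost_path u [] = V u"
| "ghost_path u (e # p) = ghost_path (head E e) p * Gh e"

lemma ghost_path_V: "awalk u p v \<Longrightarrow> ghost_path u p * V u \<approx> ghost_path u p"
  using cong_mult_left[OF Gh_V] by (cases p) (auto simp: V_idem awalk_simps mult.assoc)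

lemma ghost_pe_step:
  assumes "e \<in> arcs E" "awalk (head E e) p w"
  shows "ghost_path (tail E e) (e # p) * pe (tail E e) (e # q) \<approx> ghost_path (head E e) p * pe (head E e) q"
proof -
  let ?g = "ghost_path (head E e) p" and ?q = "pe (head E e) q"
  have "ghost_path (tail E e) (e # p) * pe (tail E e) (e # q) \<approx> ?g * Gh e * (Ed e * ?q)"
    unfolding ghost_path.simps by (rule cong_mult_left[OF Ed_pe])
  also have "\<dots> = ?g * (Gh e * Ed e) * ?q" by (simp add: mult.assoc)
  also have "\<dots> \<approx> ?g * V (head E e) * ?q"
    by (intro cong_mult_right cong_mult_left Gh_Ed_eq assms)
  also have "\<dots> \<approx> ?g * ?q"
    by (intro cong_mult_right ghost_path_V[OF assms(2)])
  finally show ?thesis .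
qed

lemma ghost_pe_same: "awalk u p w \<Longrightarrow> ghost_path u p * pe u p \<approx> V w"
proof (induction p arbitrary: u)
  case Nil
  then show ?case by (simp add: pe_Nil V_idem awalk_simps)
next
  case (Cons e p)
  then have "e \<in> arcs E" "u = tail E e" "awalk (head E e) p w" by (auto simp: awalk_simps)
  then show ?case using ghost_pe_step[of e p w p] Cons.IH cong_trans by blast
qed

text \<open>Edges cancel in pairs from the middle until the first mismatch, which kills the product.
  As \<open>p\<close> is no longer than \<open>q\<close>, the absence of a mismatch would make
  \<open>p\<close> a prefix of \<open>q\<close>.\<close>

lemma ghost_pe_orth:
  assumes "awalk u p w" "awalk v q z" "length p \<le> length q"
    and "\<not> (u = v \<and> (\<exists>r. q = p @ r))"
  shows "ghost_path u p * pe v q \<in> I"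
proof (cases "u = v")
  case False
  then show ?thesis using mult_orth[OF ghost_path_V[OF assms(1)] V_pe] by blast
next
  case True
  from assms(1-3) assms(4)[unfolded True[symmetric]] show ?thesis
    unfolding True[symmetric]
  proof (induction p arbitrary: u q)
    case (Cons e p)
    then obtain f q' where q: "q = f # q'" by (cases q) auto
    have e: "e \<in> arcs E" "u = tail E e" "awalk (head E e) p w" and f: "u = tail E f" "awalk (head E f) q' z"
      using Cons.prems q True by (auto simp: awalk_simps)
    show ?case
    proof (cases "e = f")
      case True
      then have "ghost_path (head E e) p * pe (head E e) q' \<in> I"
        using Cons q e f by (intro Cons.IH) auto
      then show ?thesis using ghost_pe_step[OF e(1,3), of q'] q e True cong_in_I by simp
    next
      case False
      have "ghost_path u (e # p) * pe u q \<approx> ghost_path (head E e) p * Gh e * (Ed f * pe (head E f) q')"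
        unfolding q f(1) ghost_path.simps by (rule cong_mult_left[OF Ed_pe])
      also have "\<dots> = ghost_path (head E e) p * (Gh e * Ed f) * pe (head E f) q'"
        by (simp add: mult.assoc)
      finally show ?thesis
        using Gh_Ed_neq[OF False] cong_in_I I_mult_left I_mult_right by metis
    qed
  qed auto
qed

end

context lpa_ideal
begin

subsection \<open>Eliminating ghost edges\<close>

text \<open>Including \<open>I\<close> makes membership depend only on the class modulo
  \<open>I\<close>.\<close>

inductive_set real_span :: "(('v, 'e) lpa_gen list \<Rightarrow>\<^sub>0 'k) set" where
  in_ideal: "x \<in> I \<Longrightarrow> x \<in> real_span"
| add: "x \<in> real_span \<Longrightarrow> y \<in> real_span \<Longrightarrow> x + y \<in> real_span"
| path: "awalk u p v \<Longrightarrow> const_poly c * pe u p \<in> real_span"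

lemma real_span_cong: "x \<approx> y \<Longrightarrow> y \<in> real_span \<Longrightarrow> x \<in> real_span"
  using real_span.add[OF real_span.in_ideal, of "x - y" y] by (simp add: cong_def)

lemma real_span_scale: "x \<in> real_span \<Longrightarrow> const_poly c * x \<in> real_span"
  by (induction rule: real_span.induct)
    (auto simp: distrib_left const_poly_mult intro: real_span.intros I_mult_left simp flip: mult.assoc)

lemma real_span_mult_Ed: "x \<in> real_span \<Longrightarrow> x * Ed e \<in> real_span"
proof (induction rule: real_span.induct)
  case (path u p v c)
  show ?case
  proof (cases "e \<in> arcs E \<and> tail E e = v")
    case True
    then have "awalk u (p @ [e]) (head E e)" using path by (auto simp: awalk_simps)
    from real_span.path[OF this, of c] show ?thesis by (simp add: pe_snoc mult.assoc)
  next
    case False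
    have "pe u p * Ed e \<in> I"
    proof (cases "e \<in> arcs E")
      case True
      with False show ?thesis using mult_orth[OF pe_V[OF path] V_Ed[of e]] by auto
    next
      case False
      then show ?thesis by (auto intro!: I_mult_left foreign_letters simp: lpa_gens_def)
    qed
    then show ?thesis by (simp add: mult.assoc I_mult_left real_span.in_ideal)
  qed
qed (auto simp: distrib_right intro: real_span.intros I_mult_right)

lemma real_span_mult_V: "x \<in> real_span \<Longrightarrow> x * V w \<in> real_span"
proof (induction rule: real_span.induct)
  case (path u p v c)
  show ?case
  proof (cases "v = w")
    case True
    have "const_poly c * pe u p * V w \<approx> const_poly c * pe u p"
      using cong_mult_left[OF pe_V[OF path]] True by (simp add: mult.assoc)
    then show ?thesis by (rule real_span_cong) (rule real_span.path[OF path])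
  next
    case False
    then show ?thesis using pe_orth[OF path False, of "[]"]
      by (simp add: pe_Nil mult.assoc I_mult_left real_span.in_ideal)
  qed
qed (auto simp: distrib_right intro: real_span.intros I_mult_right)

text \<open>The elements of \<open>ghost_filtration n\<close> become combinations of real paths
  as soon as they are multiplied by a path of length \<open>n\<close>, or by a shorter one ending in a sink.\<close>

primrec ghost_filtration :: "nat \<Rightarrow> (('v, 'e) lpa_gen list \<Rightarrow>\<^sub>0 'k) set" where
  "ghost_filtration 0 = real_span"
| "ghost_filtration (Suc n) =
     {x. (\<forall>e\<in>arcs E. x * Ed e \<in> ghost_filtration n) \<and>
         (\<forall>v\<in>verts E. out_arcs E v = {} \<longrightarrow> x * V v \<in> real_span)}"

lemma ghost_filtration_ideal: "x \<in> I \<Longrightarrow> x \<in> ghost_filtration n"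
  by (induction n arbitrary: x) (auto intro: real_span.in_ideal I_mult_right)

lemma ghost_filtration_add:
  "x \<in> ghost_filtration n \<Longrightarrow> y \<in> ghost_filtration n \<Longrightarrow> x + y \<in> ghost_filtration n"
  by (induction n arbitrary: x y) (auto intro: real_span.add simp: distrib_right)

lemma ghost_filtration_cong: "x \<approx> y \<Longrightarrow> y \<in> ghost_filtration n \<Longrightarrow> x \<in> ghost_filtration n"
  using ghost_filtration_add[OF ghost_filtration_ideal[of "x - y" n], of y] by (simp add: cong_def)

lemma ghost_filtration_scale: "x \<in> ghost_filtration n \<Longrightarrow> const_poly c * x \<in> ghost_filtration n"
  by (induction n arbitrary: x) (auto intro: real_span_scale simp: mult.assoc)

lemma ghost_filtration_Suc: "x \<in> ghost_filtration n \<Longrightarrow> x \<in> ghost_filtration (Suc n)"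
  by (induction n arbitrary: x) (auto intro: real_span_mult_Ed real_span_mult_V)

lemma ghost_filtration_mono: "m \<le> n \<Longrightarrow> x \<in> ghost_filtration m \<Longrightarrow> x \<in> ghost_filtration n"
  by (induction rule: dec_induct) (auto intro: ghost_filtration_Suc simp del: ghost_filtration.simps)

lemma ghost_filtration_mult_Ed: "x \<in> ghost_filtration n \<Longrightarrow> x * Ed e \<in> ghost_filtration n"
proof (cases n)
  case (Suc m)
  assume x: "x \<in> ghost_filtration n"
  show ?thesis
  proof (cases "e \<in> arcs E")
    case True
    then have "x * Ed e \<in> ghost_filtration m" using x Suc by simp
    then show ?thesis using ghost_filtration_Suc Suc by blast
  next
    case False
    then show ?thesis
      by (auto intro!: ghost_filtration_ideal I_mult_left foreign_letters simp: lpa_gens_def)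
  qed
qed (simp add: real_span_mult_Ed)

lemma ghost_filtration_mult_V: "x \<in> ghost_filtration n \<Longrightarrow> x * V v \<in> ghost_filtration n"
proof (cases n)
  case (Suc m)
  assume x: "x \<in> ghost_filtration n"
  have "x * V v * Ed e \<in> ghost_filtration m" if e: "e \<in> arcs E" for e
  proof (cases "tail E e = v")
    case True
    have "x * V v * Ed e \<approx> x * Ed e"
      using cong_mult_left[OF V_Ed[of e]] True by (simp add: mult.assoc)
    then show ?thesis by (rule ghost_filtration_cong) (use x e Suc in auto)
  next
    case False
    then show ?thesis using orth_left[OF V_Ed, of v e]
      by (simp add: ghost_filtration_ideal I_mult_left mult.assoc)
  qed
  moreover have "x * V v * V w \<in> real_span" if w: "w \<in> verts E" "out_arcs E w = {}" for w
  proof (cases "v = w")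
    case True
    have "x * V v * V w \<approx> x * V w"
      using cong_mult_left[OF V_idem[of w]] True by (simp add: mult.assoc)
    then show ?thesis by (rule real_span_cong) (use x w Suc in auto)
  next
    case False
    then show ?thesis 
      by (simp add: real_span.in_ideal I_mult_left V_orth mult.assoc)
  qed
  ultimately show ?thesis using Suc by simp
qed (simp add: real_span_mult_V)

text \<open>A real edge following \<open>Gh f\<close> either cancels it or kills the product, so one
  extra level suffices. A sink cannot be the tail of \<open>f\<close>, so its vertex kills the
  product as well.\<close>

lemma ghost_filtration_mult_Gh:
  assumes x: "x \<in> ghost_filtration n" shows "x * Gh f \<in> ghost_filtration (Suc n)"
proof (cases "f \<in> arcs E")
  case f: True
  have "x * Gh f * Ed e \<in> ghost_filtration n" for e
  proof (cases "f = e")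
    case True
    have "x * Gh f * Ed e \<approx> x * V (head E f)"
      using cong_mult_left[OF Gh_Ed_eq[OF f]] True by (simp add: mult.assoc)
    then show ?thesis by (rule ghost_filtration_cong) (rule ghost_filtration_mult_V[OF x])
  next
    case False
    then show ?thesis 
      by (simp add: ghost_filtration_ideal I_mult_left Gh_Ed_neq mult.assoc)
  qed
  moreover have "x * Gh f * V w \<in> real_span" if "out_arcs E w = {}" for w
  proof -
    have "w \<noteq> tail E f" using that f by auto
    then show ?thesis using orth_right[OF Gh_V[of f]]
      by (simp add: real_span.in_ideal I_mult_left mult.assoc)
  qed
  ultimately show ?thesis by simp
next
  case False
  then show ?thesis
    by (intro ghost_filtration_ideal I_mult_left foreign_letters) (auto simp: lpa_gens_def)
qed

section \<open>Ghost elimination for elements without constant term\<close>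

definition ghost_finite :: "(('v, 'e) lpa_gen list \<Rightarrow>\<^sub>0 'k) set" where
  "ghost_finite = (\<Union>n. ghost_filtration n)"

lemma ghost_finite_add:
  assumes "x \<in> ghost_finite" "y \<in> ghost_finite" shows "x + y \<in> ghost_finite"
proof -
  obtain m n where "x \<in> ghost_filtration m" "y \<in> ghost_filtration n"
    using assms by (auto simp: ghost_finite_def)
  then have "x + y \<in> ghost_filtration (max m n)"
    using ghost_filtration_mono[of m "max m n" x] ghost_filtration_mono[of n "max m n" y]
    by (auto intro: ghost_filtration_add)
  then show ?thesis by (auto simp: ghost_finite_def)
qed

lemma ghost_finite_mult:
  assumes x: "x \<in> ghost_finite" shows "x * r \<in> ghost_finite"
proof -
  have letter: "y * free_gen l \<in> ghost_finite" if "y \<in> ghost_finite" for y l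
    using that unfolding ghost_finite_def
    by (cases l) (blast intro: ghost_filtration_mult_V ghost_filtration_mult_Ed ghost_filtration_mult_Gh)+
  have words: "y * word_poly w \<in> ghost_finite" if "y \<in> ghost_finite" for y w
    using that by (induction w arbitrary: y)
      (auto simp: word_poly_Nil word_poly_Cons letter simp flip: mult.assoc)
  have "Poly_Mapping.keys r \<subseteq> UNIV" by simp
  then show ?thesis
  proof (induction r rule: poly_word_induct)
    case zero
    show ?case using ghost_filtration_ideal[OF I_zero] by (auto simp: ghost_finite_def)
  next
    case (word c w)
    have "const_poly c * x \<in> ghost_finite"
      using x ghost_filtration_scale unfolding ghost_finite_def by blast
    from words[OF this] show ?case by (simp add: single_Nil_commute flip: mult.assoc)
  qed (auto simp: distrib_left ghost_finite_add)
qed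

lemma ghost_finite_V: "V v \<in> ghost_finite"
proof (cases "v \<in> verts E")
  case True
  then have "const_poly 1 * pe v [] \<in> ghost_filtration 0"
    using real_span.path[of v "[]" v 1] by (simp add: awalk_simps)
  then show ?thesis by (auto simp: ghost_finite_def pe_Nil const_poly_one intro!: exI[of _ 0])
next
  case False
  then show ?thesis using ghost_filtration_ideal[OF V_foreign] by (auto simp: ghost_finite_def)
qed

lemma ghost_finite_cong: "x \<approx> y \<Longrightarrow> y \<in> ghost_finite \<Longrightarrow> x \<in> ghost_finite"
  using ghost_filtration_cong unfolding ghost_finite_def by blast

lemma left_unit_letter: "\<exists>v. V v * free_gen l \<approx> free_gen l"
  by (cases l) (auto intro: V_idem V_Ed V_Gh)

lemma right_unit_letter: "\<exists>v. free_gen l * V v \<approx> free_gen l"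
  by (cases l) (auto intro: V_idem Ed_V Gh_V)

text \<open>The first letter of a nonempty word absorbs a vertex on its left. Every monomial is
  therefore a right multiple of a vertex modulo \<open>I\<close>, and right multiplication raises
  the level by finitely many steps only.\<close>

lemma nonconstant_ghost_finite:
  assumes "[] \<notin> Poly_Mapping.keys x" shows "x \<in> ghost_finite"
proof -
  have "Poly_Mapping.keys x \<subseteq> {w. w \<noteq> []}" using assms by blast
  then show ?thesis
  proof (induction x rule: poly_word_induct)
    case zero
    show ?case using ghost_filtration_ideal[OF I_zero] by (auto simp: ghost_finite_def)
  next
    case (word c w)
    then obtain l w' where w: "w = l # w'" by (cases w) auto
    obtain v where v: "V v * free_gen l \<approx> free_gen l" using left_unit_letter by blast
    have "const_poly c * word_poly w = const_poly c * free_gen l * word_poly w'"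
      by (simp add: w word_poly_Cons mult.assoc)
    also have "\<dots> \<approx> const_poly c * (V v * free_gen l) * word_poly w'"
      by (intro cong_mult_right cong_mult_left cong_sym[OF v])
    also have "\<dots> = V v * (const_poly c * free_gen l * word_poly w')"
      by (simp add: mult.assoc const_poly_left_commute)
    finally show ?case by (rule ghost_finite_cong) (intro ghost_finite_mult ghost_finite_V)
  qed (auto simp: ghost_finite_add)
qed

text \<open>A finite sum of vertices that includes those absorbed by the last letters of the
  monomials fixes \<open>x\<close> on the right. Hence not every \<open>x * V v\<close> can
  vanish.\<close>

lemma right_local_unit:
  assumes "[] \<notin> Poly_Mapping.keys x" "x \<notin> I" shows "\<exists>v. x * V v \<notin> I"
proof (rule ccontr)
  assume no: "\<not> (\<exists>v. x * V v \<notin> I)"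
  have "Poly_Mapping.keys x \<subseteq> {w. w \<noteq> []}" using assms by blast
  \<comment> \<open>Quantifying over all finite supersets \<open>T\<close> lets the vertex sets of
    two summands be merged by union.\<close>
  then have "\<exists>S. finite S \<and> (\<forall>T. finite T \<longrightarrow> S \<subseteq> T \<longrightarrow> x * (\<Sum>v\<in>T. V v) \<approx> x)"
  proof (induction x rule: poly_word_induct)
    case (add f g)
    then obtain S S' where "finite S" "\<And>T. finite T \<Longrightarrow> S \<subseteq> T \<Longrightarrow> f * (\<Sum>v\<in>T. V v) \<approx> f"
      "finite S'" "\<And>T. finite T \<Longrightarrow> S' \<subseteq> T \<Longrightarrow> g * (\<Sum>v\<in>T. V v) \<approx> g" by blast
    then show ?case by (intro exI[of _ "S \<union> S'"]) (auto simp: distrib_right intro: cong_add)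
  next
    case (word c w)
    then obtain l w' where w: "w = w' @ [l]" by (cases w rule: rev_cases) auto
    obtain v where v: "free_gen l * V v \<approx> free_gen l" using right_unit_letter by blast
    have "const_poly c * word_poly w * (\<Sum>v\<in>T. V v) \<approx> const_poly c * word_poly w"
      if T: "finite T" "v \<in> T" for T
    proof -
      have "free_gen l * (\<Sum>v\<in>T. V v) = free_gen l * V v + (\<Sum>u\<in>T - {v}. free_gen l * V u)"
        using T by (simp add: sum.remove[of T v] distrib_left sum_distrib_left)
      also have "\<dots> \<approx> free_gen l + 0"
        using v by (intro cong_add) (auto simp: cong_zero intro!: I_sum orth_right[OF v])
      finally have "const_poly c * word_poly w' * (free_gen l * (\<Sum>v\<in>T. V v))
          \<approx> const_poly c * word_poly w' * free_gen l"
        by (intro cong_mult_left) simp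
      then show ?thesis by (simp add: w word_poly_snoc mult.assoc)
    qed
    then show ?case by (intro exI[of _ "{v}"]) auto
  qed auto
  then obtain S where "x * (\<Sum>v\<in>S. V v) \<approx> x" by blast
  moreover have "x * (\<Sum>v\<in>S. V v) \<in> I" using no by (auto simp: sum_distrib_left intro!: I_sum)
  ultimately show False using assms(2) cong_in_I by blast
qed

text \<open>A vertex that emits edges is regular by row-finiteness, so the relation at
  \<open>v\<close> splits \<open>x * V v\<close> into terms \<open>x * Ed e * Gh e\<close>. A
  nonzero term gives a nonzero \<open>x * Ed e\<close> one level lower; a sink ends the
  walk.\<close>

lemma ghost_elimination:
  assumes rf: "row_finite E"
  shows "x \<in> ghost_filtration n \<Longrightarrow> x * V v \<notin> I \<Longrightarrow>
    \<exists>p z. awalk v p z \<and> x * pe v p \<in> real_span \<and> x * pe v p \<notin> I"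
proof (induction n arbitrary: x v)
  case 0
  then have "v \<in> verts E" using V_foreign I_mult_left by blast
  then show ?case using 0 real_span_mult_V by (intro exI[of _ "[]"]) (auto simp: pe_Nil awalk_simps)
next
  case (Suc n)
  have v: "v \<in> verts E" using Suc.prems(2) V_foreign I_mult_left by blast
  show ?case
  proof (cases "out_arcs E v = {}")
    case True
    then show ?thesis using Suc.prems v by (intro exI[of _ "[]"]) (auto simp: pe_Nil awalk_simps)
  next
    case False
    then have "v \<in> regular_verts E" using rf v by (auto simp: regular_verts_def row_finite_def)
    then have "x * V v \<approx> x * (\<Sum>e\<in>out_arcs E v. Ed e * Gh e)"
      by (intro cong_mult_left V_regular)
    also have "\<dots> = (\<Sum>e\<in>out_arcs E v. x * Ed e * Gh e)" by (simp add: sum_distrib_left mult.assoc)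
    finally have "(\<Sum>e\<in>out_arcs E v. x * Ed e * Gh e) \<notin> I" using Suc.prems(2) cong_in_I by blast
    then obtain e where e: "e \<in> out_arcs E v" "x * Ed e * Gh e \<notin> I" using I_sum by meson
    then have e': "e \<in> arcs E" "tail E e = v" "x * Ed e \<notin> I" by (auto intro: I_mult_right)
    have "x * Ed e * V (head E e) \<approx> x * Ed e"
      using cong_mult_left[OF Ed_V[of e]] by (simp add: mult.assoc)
    then have "x * Ed e * V (head E e) \<notin> I" using e' cong_in_I by blast
    moreover have "x * Ed e \<in> ghost_filtration n" using Suc.prems(1) e' by simp
    ultimately obtain p z where p: "awalk (head E e) p z" "x * Ed e * pe (head E e) p \<in> real_span"
      "x * Ed e * pe (head E e) p \<notin> I" using Suc.IH by blast
    have c: "x * pe v (e # p) \<approx> x * Ed e * pe (head E e) p"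
      using cong_mult_left[OF Ed_pe[of e p]] e' by (simp add: mult.assoc)
    have "awalk v (e # p) z" using p e' by (auto simp: awalk_simps)
    then show ?thesis using c p real_span_cong cong_in_I by blast
  qed
qed

text \<open>A representative whose monomials are literally paths has a finite support in which
  individual paths can be selected.\<close>

lemma real_span_normal_form:
  assumes "x \<in> real_span"
  shows "\<exists>f. x \<approx> f \<and>
    (\<forall>k\<in>Poly_Mapping.keys f. \<exists>u p v. k = Vert u # map Edge p \<and> awalk u p v)"
  using assms
proof (induction rule: real_span.induct)
  case (in_ideal x)
  then show ?case by (intro exI[of _ 0]) (simp add: cong_zero)
next
  case (add x y)
  then obtain f g where fg: "x \<approx> f" "y \<approx> g"
    "\<forall>k\<in>Poly_Mapping.keys f. \<exists>u p v. k = Vert u # map Edge p \<and> awalk u p v"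
    "\<forall>k\<in>Poly_Mapping.keys g. \<exists>u p v. k = Vert u # map Edge p \<and> awalk u p v" by blast
  have "\<exists>u p v. k = Vert u # map Edge p \<and> awalk u p v" if "k \<in> Poly_Mapping.keys (f + g)" for k
    using subsetD[OF keys_add that] fg(3,4) by blast
  then show ?case using fg(1,2) cong_add by blast
next
  case (path u p v c)
  then show ?case
    by (intro exI[of _ "const_poly c * pe u p"])
      (auto simp: pe_def simp flip: single_eq_const_poly_times split: if_splits)
qed

text \<open>Multiplying by a path \<open>q\<close> from \<open>v\<close> to \<open>u\<close> turns
  \<open>V w * y\<close> into a nonzero combination of real paths. A monomial that survives
  multiplication by \<open>V w\<close> and \<open>V u\<close> is a path from \<open>w\<close> to
  \<open>u\<close>.\<close>

lemma common_descendant: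
  assumes rf: "row_finite E" and nz: "V w * y * V v \<notin> I"
  shows "\<exists>u p q. awalk w p u \<and> awalk v q u"
proof -
  have "V w * y \<in> ghost_finite" by (intro ghost_finite_mult ghost_finite_V)
  then obtain n where "V w * y \<in> ghost_filtration n" by (auto simp: ghost_finite_def)
  from ghost_elimination[OF rf this nz] obtain q u where q: "awalk v q u"
    "V w * y * pe v q \<in> real_span" "V w * y * pe v q \<notin> I" by blast
  let ?h = "V w * y * pe v q"
  obtain f where f: "?h \<approx> f"
    "\<forall>k\<in>Poly_Mapping.keys f. \<exists>u p v. k = Vert u # map Edge p \<and> awalk u p v"
    using real_span_normal_form[OF q(2)] by blast
  have "V w * f * V u \<approx> V w * ?h * V u"
    by (intro cong_mult_right cong_mult_left cong_sym[OF f(1)])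
  also have "\<dots> = V w * V w * (y * (pe v q * V u))" by (simp add: mult.assoc)
  also have "\<dots> \<approx> V w * (y * pe v q)"
    by (intro cong_mult V_idem pe_V q) simp
  finally have "V w * f * V u \<approx> ?h" by (simp add: mult.assoc)
  then have "V w * f * V u \<notin> I" using q(3) cong_in_I by blast
  moreover have "V w * f * V u = (\<Sum>k\<in>Poly_Mapping.keys f.
      V w * (const_poly (Poly_Mapping.lookup f k) * word_poly k) * V u)" (is "_ = sum ?t _")
    by (subst (1) poly_eq_sum_words[of f]) (simp only: sum_distrib_left sum_distrib_right)
  ultimately have "\<exists>k\<in>Poly_Mapping.keys f. ?t k \<notin> I"
    using I_sum[of "Poly_Mapping.keys f" ?t] by auto
  then obtain k where k: "k \<in> Poly_Mapping.keys f"
    "V w * (const_poly (Poly_Mapping.lookup f k) * word_poly k) * V u \<notin> I" by blast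
  obtain u' p v' where "k = Vert u' # map Edge p" and p2: "awalk u' p v'"
    using f(2) k(1) by blast
  then have p: "word_poly k = pe u' p" "awalk u' p v'" by (simp_all add: pe_def)
  have "V w * pe u' p \<notin> I"
  proof
    assume "V w * pe u' p \<in> I"
    then have "const_poly (Poly_Mapping.lookup f k) * (V w * pe u' p) * V u \<in> I"
      by (rule I_mult_right[OF I_mult_left])
    then show False using k(2) p(1) by (simp add: mult.assoc const_poly_left_commute)
  qed
  then have "w = u'" using orth_left[OF V_pe] by blast
  moreover have "pe u' p * V u \<notin> I"
  proof
    assume "pe u' p * V u \<in> I"
    then have "V w * const_poly (Poly_Mapping.lookup f k) * (pe u' p * V u) \<in> I"
      by (rule I_mult_left)
    then show False using k(2) p(1) by (simp add: mult.assoc)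
  qed
  then have "v' = u" using orth_right[OF pe_V[OF p(2)]] by blast
  ultimately show ?thesis using p q by blast
qed

end

subsection \<open>Condition (L) and the reduction to a vertex\<close>

text \<open>The cycle is found in the subgraph whose only arcs are those of \<open>q\<close>, so it
  cannot use any other arc.\<close>

lemma (in wf_digraph) closed_walk_contains_cycle:
  assumes "awalk u q u" "q \<noteq> []"
  obtains c where "cycle c" "set c \<subseteq> set q"
proof -
  let ?G = "G\<lparr>arcs := set q\<rparr>"
  have sub: "set q \<subseteq> arcs G" using assms by (auto simp: awalk_def)
  interpret H: wf_digraph ?G by unfold_locales (use sub in auto)
  have cas: "H.cas x p y = cas x p y" for x p y
    by (induction p arbitrary: x) auto
  have "H.awalk u q u" using assms by (auto simp: awalk_def H.awalk_def cas)
  then obtain c where c: "H.cycle c"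
    using H.closed_w_imp_cycle[of q] assms by (auto simp: H.closed_w_def)
  have "H.awalk_verts x p = awalk_verts x p" for x p
    by (induction p arbitrary: x) auto
  moreover have "set c \<subseteq> set q" using c by (auto simp: H.cycle_def H.awalk_def)
  moreover from this sub have "set c \<subseteq> arcs G" by (rule subset_trans)
  ultimately have "cycle c" "set c \<subseteq> set q"
    using c by (auto simp: cycle_def H.cycle_def awalk_def H.awalk_def cas)
  then show ?thesis by (rule that)
qed

text \<open>Condition (L) speaks of cycles only; an exit of a cycle inside \<open>q\<close> leaves
  \<open>q\<close> at the position of the same edge.\<close>

lemma (in wf_digraph) condition_L_closed_walk:
  assumes L: "condition_L G" and q: "awalk u q u" "q \<noteq> []"
  obtains i f where "i < length q" "f \<in> arcs G" "tail G f = tail G (q ! i)" "f \<noteq> q ! i"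
proof -
  obtain c where c: "cycle c" "set c \<subseteq> set q" by (rule closed_walk_contains_cycle[OF q])
  obtain f j where f: "f \<in> arcs G" "j < length c" "tail G f = tail G (c ! j)" "f \<noteq> c ! j"
    using L c(1) by (auto simp: condition_L_def is_exit_def)
  then obtain i where "i < length q" "q ! i = c ! j"
    using c(2) by (meson in_set_conv_nth nth_mem subsetD)
  then show ?thesis using f that by metis
qed

lemma (in wf_digraph) awalk_power: "awalk w q w \<Longrightarrow> awalk w (concat (replicate n q)) w"
  by (induction n) (auto simp: awalk_simps)

text \<open>If \<open>g\<close> is a prefix of \<open>q @ g\<close> then it runs along \<open>q\<^sup>\<infinity>\<close>, and an exit of \<open>q\<close> lets it leave that
  infinite path; longer walks inherit the property from their prefixes.\<close>

lemma (in wf_digraph) escape_closed_walks: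
  assumes L: "condition_L G" and "finite B" and "w \<in> verts G"
    and "\<And>q. q \<in> B \<Longrightarrow> awalk w q w \<and> q \<noteq> []"
  shows "\<exists>g z. awalk w g z \<and> (\<forall>q\<in>B. take (length g) (q @ g) \<noteq> g)"
  using assms(2,4)
proof (induction B rule: finite_induct)
  case empty
  then show ?case using \<open>w \<in> verts G\<close> by (intro exI[of _ "[]"]) (auto simp: awalk_simps)
next
  case (insert q B)
  then obtain g z where g: "awalk w g z" "\<And>q. q \<in> B \<Longrightarrow> take (length g) (q @ g) \<noteq> g" by blast
  show ?case
  proof (cases "take (length g) (q @ g) = g")
    case False
    then show ?thesis using g by blast
  next
    case True
    \<comment> \<open>Each copy of the nonempty \<open>q\<close> contributes at least one edge, so
      \<open>length g\<close> copies are long enough to contain \<open>g\<close> as a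
      prefix.\<close>
    define Q where "Q = concat (replicate (length g) q)"
    have q: "awalk w q w" "q \<noteq> []" using insert.prems by auto
    have along: "take (length g) (concat (replicate n q) @ g) = g" for n
    proof (induction n)
      case (Suc n)
      have "take (length g) (q @ h) = take (length g) (q @ take (length g) h)" for h
        by (simp add: min_def)
      then have "take (length g) (concat (replicate (Suc n) q) @ g)
          = take (length g) (q @ take (length g) (concat (replicate n q) @ g))"
        by (metis append_assoc concat.simps(2) replicate_Suc)
      then show ?case by (simp only: Suc True)
    qed simp
    have "length g \<le> length Q"
      using q(2) by (cases q) (auto simp: Q_def length_concat sum_list_replicate)
    then have "take (length g) Q = g" using along[of "length g"] by (simp add: Q_def)
    then obtain d where d: "Q = g @ d" by (metis append_take_drop_id)
    obtain i f where f: "i < length q" "f \<in> arcs G" "tail G f = tail G (q ! i)" "f \<noteq> q ! i"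
      by (rule condition_L_closed_walk[OF L q])
    \<comment> \<open>The new walk extends \<open>g\<close>, runs along copies of \<open>q\<close>,
      and then takes \<open>f\<close> where \<open>q\<close> would continue with
      \<open>q ! i\<close>.\<close>
    let ?g = "Q @ take i q @ [f]"
    have "awalk w (take i q @ q ! i # drop (Suc i) q) w"
      using q(1) id_take_nth_drop[OF f(1)] by metis
    then have "awalk w (take i q) (tail G f)" using f(3) by (auto simp: awalk_simps)
    moreover have "awalk w Q w" unfolding Q_def by (rule awalk_power[OF q(1)])
    ultimately have "awalk w ?g (head G f)" using f(2) by (auto simp: awalk_simps)
    moreover have "take (length ?g) (q' @ ?g) \<noteq> ?g" if q': "q' \<in> B" for q'
    proof
      assume eq: "take (length ?g) (q' @ ?g) = ?g"
      obtain d' where d': "?g = g @ d'" by (simp add: d)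
      have "take (length g) (q' @ g) = take (length g) (take (length (g @ d')) (q' @ g @ d'))"
        by (simp add: min_def)
      also have "\<dots> = g" using eq unfolding d' by simp
      finally have "take (length g) (q' @ g) = g" .
      then show False using g(2) q' by blast
    qed
    moreover have "take (length ?g) (q @ ?g) \<noteq> ?g"
    proof
      assume eq: "take (length ?g) (q @ ?g) = ?g"
      \<comment> \<open>Since \<open>q\<close> commutes with its powers, both sides of
        \<open>eq\<close> begin with \<open>Q\<close>; after it, \<open>take (Suc i) q\<close> would
        have to equal \<open>take i q @ [f]\<close>.\<close>
      have "q @ Q = Q @ q"
        unfolding Q_def by (induction g) auto
      then have "q @ ?g = Q @ q @ take i q @ [f]" by (metis append_assoc)
      then have "take (length ?g) (q @ ?g) = take (length ?g) (Q @ q @ take i q @ [f])"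
        by (simp only:)
      also have "\<dots> = Q @ take (Suc i) q" using f(1) by simp
      finally have "take (Suc i) q = take i q @ [f]" using eq by simp
      then show False using f(1,4) by (simp add: take_Suc_conv_app_nth)
    qed
    ultimately show ?thesis by (intro exI[of _ ?g] exI[of _ "head G f"]) auto
  qed
qed

section \<open>Compression of a nonzero element to a vertex\<close>

context lpa_ideal
begin

text \<open>Compressing by the ghost of \<open>p0 @ g\<close> on the left and by \<open>g\<close> on
  the right sends the shortest path \<open>p0\<close> to a vertex and all other monomials to
  zero.\<close>

lemma real_span_reduction:
  assumes L: "condition_L E" and x: "x \<in> real_span" "x \<notin> I"
  shows "\<exists>a b v. v \<in> verts E \<and> a * x * b \<approx> V v"
proof -
  obtain f where f: "x \<approx> f"
    "\<And>k. k \<in> Poly_Mapping.keys f \<Longrightarrow> \<exists>u p v. k = Vert u # map Edge p \<and> awalk u p v"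
    using real_span_normal_form[OF x(1)] by blast
  let ?K = "Poly_Mapping.keys f" and ?c = "Poly_Mapping.lookup f"
  have "f \<noteq> 0" using x(2) f(1) cong_zero by blast
  then obtain k' where "k' \<in> ?K" by (metis all_not_in_conv keys_eq_empty)
  then obtain k0 where k0: "k0 \<in> ?K" "\<And>k. k \<in> ?K \<Longrightarrow> length k0 \<le> length k"
    using ex_has_least_nat[of "\<lambda>k. k \<in> ?K" k' length] by blast
  obtain u0 p0 w where p0: "k0 = Vert u0 # map Edge p0" "awalk u0 p0 w" using f(2)[OF k0(1)] by blast
  \<comment> \<open>These closed walks give the only monomials besides \<open>k0\<close> that the
    compression could leave over; there are finitely many because the support of \<open>f\<close> is
    finite.\<close>
  define B where "B = {q. q \<noteq> [] \<and> awalk w q w \<and> Vert u0 # map Edge (p0 @ q) \<in> ?K}"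
  have "finite ((\<lambda>q. Vert u0 # map Edge (p0 @ q)) ` B)"
    by (rule finite_subset[of _ ?K]) (auto simp: B_def)
  moreover have "inj_on (\<lambda>q. Vert u0 # map (Edge :: 'e \<Rightarrow> ('v, 'e) lpa_gen) (p0 @ q)) B"
    by (auto simp: inj_on_def inj_map_eq_map inj_def)
  ultimately have "finite B" by (rule finite_imageD)
  obtain g z where g: "awalk w g z" "\<And>q. q \<in> B \<Longrightarrow> take (length g) (q @ g) \<noteq> g"
    using escape_closed_walks[OF L \<open>finite B\<close> awalk_last_in_verts[OF p0(2)]] by (auto simp: B_def)
  let ?a = "ghost_path u0 (p0 @ g)" and ?b = "pe w g"
  have p0g: "awalk u0 (p0 @ g) z" using p0(2) g(1) by auto
  have lead: "?a * (word_poly k0 * ?b) \<approx> V z"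
  proof -
    have "?a * (pe u0 p0 * ?b) \<approx> ?a * pe u0 (p0 @ g)"
      by (rule cong_mult_left[OF pe_append[OF p0(2)]])
    also have "\<dots> \<approx> V z" by (rule ghost_pe_same[OF p0g])
    finally show ?thesis by (simp add: p0 pe_def)
  qed
  have rest: "?a * (word_poly k * ?b) \<in> I" if k: "k \<in> ?K" "k \<noteq> k0" for k
  proof -
    obtain u p v where p: "k = Vert u # map Edge p" "awalk u p v" using f(2)[OF k(1)] by blast
    have kp: "word_poly k = pe u p" by (simp add: p pe_def)
    show ?thesis
    proof (cases "v = w")
      case False
      then show ?thesis using pe_orth[OF p(2) False] by (simp add: kp I_mult_left)
    next
      case True
      have len: "length p0 \<le> length p" using k0(2)[OF k(1)] p p0 by simp
      \<comment> \<open>Minimality of \<open>p0\<close> would force \<open>p = p0 @ q\<close> with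
        \<open>q\<close> in \<open>B\<close>, and then \<open>g\<close> would be a prefix of
        \<open>q @ g\<close>, contrary to its choice.\<close>
      have "\<not> (u0 = u \<and> (\<exists>r. p @ g = (p0 @ g) @ r))"
      proof
        assume "u0 = u \<and> (\<exists>r. p @ g = (p0 @ g) @ r)"
        then obtain r where r: "u0 = u" "p @ g = p0 @ g @ r" by auto
        have "take (length p0) p = p0"
          using len arg_cong[OF r(2), of "take (length p0)"] by simp
        then obtain q where q: "p = p0 @ q" by (metis append_take_drop_id)
        then have "q @ g = g @ r" using r by simp
        then have "take (length g) (q @ g) = g" by simp
        moreover have "q \<noteq> []" using k(2) q p p0 r by auto
        moreover have "awalk w q w"
        proof -
          obtain m where m: "awalk u0 p0 m" "awalk m q w" using p(2) True q r(1) by auto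
          then have "m = w" using awalk_ends[OF m(1) p0(2)] by blast
          then show ?thesis using m by simp
        qed
        ultimately show False using g(2)[of q] k(1) p(1) q r(1) by (auto simp: B_def)
      qed
      then have "?a * pe u (p @ g) \<in> I"
        using p(2) g(1) True len by (intro ghost_pe_orth[OF p0g]) auto
      moreover have "?a * (pe u p * ?b) \<approx> ?a * pe u (p @ g)"
        using p(2) True by (intro cong_mult_left pe_append) simp
      ultimately show ?thesis unfolding kp using cong_in_I by blast
    qed
  qed
  have "?a * f * ?b = (\<Sum>k\<in>?K. const_poly (?c k) * (?a * (word_poly k * ?b)))"
    by (subst (1) poly_eq_sum_words[of f])
      (simp add: sum_distrib_left sum_distrib_right mult.assoc const_poly_left_commute)
  also have "\<dots> = const_poly (?c k0) * (?a * (word_poly k0 * ?b))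
      + (\<Sum>k\<in>?K - {k0}. const_poly (?c k) * (?a * (word_poly k * ?b)))"
    using k0(1) by (intro sum.remove) auto
  also have "\<dots> \<approx> const_poly (?c k0) * V z + 0"
  proof (rule cong_add[OF cong_mult_left[OF lead]])
    show "(\<Sum>k\<in>?K - {k0}. const_poly (?c k) * (?a * (word_poly k * ?b))) \<approx> 0"
      unfolding cong_zero by (rule I_sum, rule I_mult_left, rule rest) auto
  qed
  finally have "const_poly (1 / ?c k0) * (?a * f * ?b) \<approx> const_poly (1 / ?c k0) * (const_poly (?c k0) * V z)"
    by (intro cong_mult_left) simp
  also have "\<dots> = V z"
    using k0(1) by (simp add: const_poly_mult const_poly_one in_keys_iff flip: mult.assoc)
  finally have "const_poly (1 / ?c k0) * ?a * f * ?b \<approx> V z" by (simp add: mult.assoc)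
  moreover have "const_poly (1 / ?c k0) * ?a * x * ?b \<approx> const_poly (1 / ?c k0) * ?a * f * ?b"
    by (intro cong_mult_right cong_mult_left f(1))
  moreover have "z \<in> verts E" using g(1) by auto
  ultimately show ?thesis using cong_trans by blast
qed

text \<open>A right local unit supplies the vertex at which ghost elimination starts; the resulting
  combination of real paths is then compressed.\<close>

theorem reduction:
  assumes "row_finite E" "condition_L E" "[] \<notin> Poly_Mapping.keys x" "x \<notin> I"
  shows "\<exists>a b v. v \<in> verts E \<and> a * x * b \<approx> V v"
proof -
  obtain v where v: "x * V v \<notin> I" using right_local_unit assms by blast
  obtain n where "x \<in> ghost_filtration n"
    using nonconstant_ghost_finite[OF assms(3)] by (auto simp: ghost_finite_def)
  from ghost_elimination[OF assms(1) this v] obtain p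
    where "x * pe v p \<in> real_span" "x * pe v p \<notin> I" by blast
  from real_span_reduction[OF assms(2) this] show ?thesis by (metis mult.assoc)
qed

end

section \<open>Vertices are nonzero\<close>

text \<open>The Leavitt path algebra acts on functions on \<open>verts E \<times> nat\<close>: if \<open>v\<close> emits \<open>n\<close> edges, the
  edge with index \<open>i\<close> identifies the fibre over its head with the elements of the fibre over \<open>v\<close>
  that are congruent to \<open>i\<close> modulo \<open>n\<close>. Dually, each letter is a partial map on the points.\<close>

definition arc_index :: "('v, 'e) pre_digraph \<Rightarrow> 'e \<Rightarrow> nat" where
  "arc_index E e = (let S = out_arcs E (tail E e) in (SOME h. bij_betw h S {0..<card S}) e)"

text \<open>With \<open>n\<close> the out-degree of the tail, an edge checks that the last
  base-\<open>n\<close> digit of \<open>m\<close> is its index and drops it; the ghost edge appends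
  that digit again. \<open>None\<close> stands for an undefined value.\<close>

fun letter_step :: "('v, 'e) pre_digraph \<Rightarrow> ('v, 'e) lpa_gen \<Rightarrow> ('v \<times> nat) option \<Rightarrow> ('v \<times> nat) option"
  where
  "letter_step E x None = None"
| "letter_step E (Vert w) (Some (v, m)) = (if v = w \<and> w \<in> verts E then Some (v, m) else None)"
| "letter_step E (Edge e) (Some (v, m)) =
     (if e \<in> arcs E \<and> v = tail E e \<and> m mod card (out_arcs E v) = arc_index E e
      then Some (head E e, m div card (out_arcs E v)) else None)"
| "letter_step E (Ghost e) (Some (v, m)) =
     (if e \<in> arcs E \<and> v = head E e
      then Some (tail E e, m * card (out_arcs E (tail E e)) + arc_index E e) else None)"

definition word_step ::
    "('v, 'e) pre_digraph \<Rightarrow> ('v, 'e) lpa_gen list \<Rightarrow> ('v \<times> nat) option \<Rightarrow> ('v \<times> nat) option" where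
  "word_step E w = fold (letter_step E) w"

text \<open>Pulling functions back reverses composition, so reading words from left to right gives a
  left action.\<close>

definition act :: "('v, 'e) pre_digraph \<Rightarrow> (('v, 'e) lpa_gen list \<Rightarrow>\<^sub>0 'k::field) \<Rightarrow>
    (('v \<times> nat) option \<Rightarrow> 'k) \<Rightarrow> ('v \<times> nat) option \<Rightarrow> 'k" where
  "act E f \<phi> p = (\<Sum>w\<in>Poly_Mapping.keys f. Poly_Mapping.lookup f w * \<phi> (word_step E w p))"

lemma word_step_None [simp]: "word_step E w None = None"
  by (induction w) (auto simp: word_step_def)

lemma word_step_append: "word_step E (u @ w) p = word_step E w (word_step E u p)"
  by (simp add: word_step_def)

lemma act_superset:
  assumes "finite S" "Poly_Mapping.keys f \<subseteq> S"
  shows "act E f \<phi> p = (\<Sum>w\<in>S. Poly_Mapping.lookup f w * \<phi> (word_step E w p))"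
  unfolding act_def using assms by (intro sum.mono_neutral_left) (auto simp: in_keys_iff)

lemma act_zero: "act E 0 \<phi> p = 0"
  by (simp add: act_def)

lemma act_add: "act E (f + g) \<phi> p = act E f \<phi> p + act E g \<phi> p"
proof -
  let ?S = "Poly_Mapping.keys f \<union> Poly_Mapping.keys g"
  have "act E f \<phi> p = (\<Sum>w\<in>?S. Poly_Mapping.lookup f w * \<phi> (word_step E w p))"
    "act E g \<phi> p = (\<Sum>w\<in>?S. Poly_Mapping.lookup g w * \<phi> (word_step E w p))"
    "act E (f + g) \<phi> p = (\<Sum>w\<in>?S. Poly_Mapping.lookup (f + g) w * \<phi> (word_step E w p))"
    by (rule act_superset; use keys_add[of f g] in simp)+
  then show ?thesis by (simp add: lookup_add algebra_simps sum.distrib)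
qed

lemma act_diff: "act E (f - g) \<phi> p = act E f \<phi> p - act E g \<phi> p"
  using act_add[of E "f - g" g \<phi> p] by simp

lemma act_sum: "act E (sum F S) \<phi> p = (\<Sum>x\<in>S. act E (F x) \<phi> p)"
  by (induction S rule: infinite_finite_induct) (auto simp: act_zero act_add)

lemma act_single: "act E (Poly_Mapping.single w c) \<phi> p = c * \<phi> (word_step E w p)"
  using act_superset[of "{w}" "Poly_Mapping.single w c"] by simp

lemma act_single_mult_left:
  "act E (Poly_Mapping.single w c * f) \<phi> p = c * act E f \<phi> (word_step E w p)"
proof -
  have "Poly_Mapping.keys f \<subseteq> UNIV" by simp
  then show ?thesis
    by (induction f rule: poly_word_induct)
      (auto simp: act_zero act_add distrib_left mult_single plus_list_def act_single
        word_step_append mult.assoc simp flip: single_eq_const_poly_times)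
qed

lemma act_single_mult_right:
  "act E (f * Poly_Mapping.single w c) \<phi> p = c * act E f (\<lambda>q. \<phi> (word_step E w q)) p"
proof -
  have "Poly_Mapping.keys f \<subseteq> UNIV" by simp
  then show ?thesis
    by (induction f rule: poly_word_induct)
      (auto simp: act_zero act_add distrib_left distrib_right mult_single plus_list_def act_single
        word_step_append mult_ac simp flip: single_eq_const_poly_times)
qed

lemma act_letter: "act E (free_gen x) \<phi> p = \<phi> (letter_step E x p)"
  by (simp add: free_gen_def act_single word_step_def)

lemma act_letters: "act E (free_gen x * free_gen y) \<phi> p = \<phi> (letter_step E y (letter_step E x p))"
  by (simp add: free_gen_def act_single act_single_mult_left word_step_def)

text \<open>Only functions vanishing at \<open>None\<close> are tested, so that an undefined step
  counts as zero.\<close>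

definition act_kernel :: "('v, 'e) pre_digraph \<Rightarrow> (('v, 'e) lpa_gen list \<Rightarrow>\<^sub>0 'k::field) set" where
  "act_kernel E = {f. \<forall>\<phi> p. \<phi> None = 0 \<longrightarrow> act E f \<phi> p = 0}"

lemma ring_ideal_act_kernel: "ring_ideal (act_kernel E :: (_ \<Rightarrow>\<^sub>0 'k::field) set)"
proof -
  have "r * f \<in> act_kernel E \<and> f * r \<in> act_kernel E" if f: "f \<in> act_kernel E"
    for r f :: "('a, 'b) lpa_gen list \<Rightarrow>\<^sub>0 'k"
  proof -
    have "Poly_Mapping.keys r \<subseteq> UNIV" by simp
    then show ?thesis
    proof (induction r rule: poly_word_induct)
      case (word c w)
      show ?case using f
        by (simp add: act_kernel_def act_single_mult_left act_single_mult_right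
            flip: single_eq_const_poly_times)
    qed (auto simp: act_kernel_def act_zero act_add distrib_left distrib_right)
  qed
  then show ?thesis
    by (auto simp: ring_ideal_def) (auto simp: act_kernel_def act_zero act_add)
qed

context
  fixes E :: "('v, 'e) pre_digraph"
  assumes wf: "wf_digraph E" and rf: "row_finite E"
begin

interpretation wf_digraph E by (rule wf)

lemma arc_index_bij:
  assumes "v \<in> verts E" shows "bij_betw (arc_index E) (out_arcs E v) {0..<card (out_arcs E v)}"
proof -
  let ?S = "out_arcs E v"
  have "\<exists>h. bij_betw h ?S {0..<card ?S}"
    using rf assms by (intro ex_bij_betw_finite_nat) (auto simp: row_finite_def)
  then have "bij_betw (SOME h. bij_betw h ?S {0..<card ?S}) ?S {0..<card ?S}" by (rule someI_ex)
  moreover have "arc_index E e = (SOME h. bij_betw h ?S {0..<card ?S}) e" if "e \<in> ?S" for e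
    using that by (auto simp: arc_index_def Let_def)
  ultimately show ?thesis by (metis (no_types, lifting) bij_betw_cong)
qed

lemma arc_index_less: "e \<in> arcs E \<Longrightarrow> arc_index E e < card (out_arcs E (tail E e))"
  using bij_betwE[OF arc_index_bij[of "tail E e"]] by auto

lemma arc_index_inj:
  "e \<in> arcs E \<Longrightarrow> f \<in> arcs E \<Longrightarrow> tail E e = tail E f \<Longrightarrow> arc_index E e = arc_index E f \<Longrightarrow> e = f"
  using bij_betw_imp_inj_on[OF arc_index_bij[of "tail E e"]] by (auto simp: inj_on_def)

text \<open>The index of \<open>e\<close> is below the out-degree, so quotient and remainder recover
  \<open>m\<close> and the index. Edges with the same tail are told apart by their indices.\<close>

lemma act_ghost_edge:
  assumes e: "e \<in> arcs E" and f: "f \<in> arcs E" and \<phi>: "\<phi> None = 0"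
  shows "act E (free_gen (Ghost e) * free_gen (Edge f)) \<phi> p =
    act E (if e = f then free_gen (Vert (head E e)) else 0) \<phi> p"
proof (cases p)
  case (Some a)
  obtain v m where a: "a = (v, m)" by (cases a)
  let ?n = "card (out_arcs E (tail E e))"
  have "(m * ?n + arc_index E e) mod ?n = arc_index E e" "(m * ?n + arc_index E e) div ?n = m"
    using arc_index_less[OF e] by simp_all
  moreover have "e = f" if "tail E e = tail E f" "arc_index E e = arc_index E f"
    using arc_index_inj[OF e f that] .
  ultimately have "letter_step E (Edge f) (letter_step E (Ghost e) p)
      = (if e = f then letter_step E (Vert (head E e)) p else None)"
    using e f by (cases "e = f"; cases "v = head E e") (auto simp: Some a)
  then show ?thesis using \<phi> by (simp add: act_letters act_letter act_zero)
qed (auto simp: act_letters act_letter act_zero \<phi>)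

text \<open>Exactly one edge at \<open>v\<close> has index \<open>m mod ?n\<close>. Its summand
  returns the point \<open>(v, m)\<close> to itself, and all other summands vanish there.\<close>

lemma act_regular:
  assumes v: "v \<in> regular_verts E" and \<phi>: "\<phi> None = 0"
  shows "act E (\<Sum>e\<in>out_arcs E v. free_gen (Edge e) * free_gen (Ghost e)) \<phi> p
    = act E (free_gen (Vert v)) \<phi> p"
proof (cases "\<exists>m. p = Some (v, m)")
  case True
  then obtain m where p: "p = Some (v, m)" by blast
  have v': "v \<in> verts E" "finite (out_arcs E v)" "out_arcs E v \<noteq> {}"
    using v by (auto simp: regular_verts_def)
  let ?n = "card (out_arcs E v)"
  have "m mod ?n \<in> {0..<?n}" using v' by (simp add: card_gt_0_iff)
  then obtain f where f: "f \<in> out_arcs E v" "arc_index E f = m mod ?n"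
    using bij_betw_imp_surj_on[OF arc_index_bij[OF v'(1)]] by (metis image_iff)
  have "act E (free_gen (Edge e) * free_gen (Ghost e)) \<phi> p = (if e = f then \<phi> p else 0)"
    if e: "e \<in> out_arcs E v" for e
  proof (cases "e = f")
    case True
    then show ?thesis using f by (simp add: act_letters p)
  next
    case False
    then have "arc_index E e \<noteq> m mod ?n" using arc_index_inj[of e f] e f by auto
    then have "letter_step E (Edge e) p = None" using e by (simp add: p)
    then show ?thesis using False \<phi> by (simp add: act_letters)
  qed
  then have "(\<Sum>e\<in>out_arcs E v. act E (free_gen (Edge e) * free_gen (Ghost e)) \<phi> p) = \<phi> p"
    using f(1) v' by simp
  then show ?thesis using v' by (simp add: act_sum act_letter p)
next
  case False
  have "letter_step E (Vert v) p = None"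
    using False by (cases p) (auto split: if_splits)
  moreover have "letter_step E (Edge e) p = None" if "e \<in> out_arcs E v" for e
    using False that by (cases p) (auto split: if_splits)
  ultimately show ?thesis using \<phi> by (simp add: act_sum act_letter act_letters)
qed

lemma lpa_relations_act_kernel: "lpa_relations E \<subseteq> (act_kernel E :: (_ \<Rightarrow>\<^sub>0 'k::field) set)"
proof -
  have rel: "f - g \<in> act_kernel E" if "\<And>\<phi> p. \<phi> None = 0 \<Longrightarrow> act E f \<phi> p = act E g \<phi> p"
    for f g :: "('v, 'e) lpa_gen list \<Rightarrow>\<^sub>0 'k"
    using that by (auto simp: act_kernel_def act_diff)
  have mono: "act E (free_gen x * free_gen y) \<phi> p = act E (free_gen z) \<phi> p"
    if "\<And>v m. letter_step E y (letter_step E x (Some (v, m))) = letter_step E z (Some (v, m))"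
    for x y z and \<phi> :: "_ \<Rightarrow> 'k" and p
    using that by (cases p) (auto simp: act_letters act_letter)
  have vv: "act E (free_gen (Vert v) * free_gen (Vert w)) \<phi> p =
      act E (if v = w then free_gen (Vert v) else 0) \<phi> p"
    if "\<phi> None = 0" for v w and \<phi> :: "_ \<Rightarrow> 'k" and p
    using that by (cases p) (auto simp: act_letters act_letter act_zero split: if_splits)
  show ?thesis
    unfolding lpa_relations_def
    by (intro Un_least subsetI; elim CollectE exE conjE; hypsubst; rule rel)
      (rule vv mono act_ghost_edge act_regular[symmetric]; auto)+
qed

lemma Vert_notin_act_kernel:
  assumes "v \<in> verts E" shows "(free_gen (Vert v) :: _ \<Rightarrow>\<^sub>0 'k::field) \<notin> act_kernel E"
proof
  assume "(free_gen (Vert v) :: _ \<Rightarrow>\<^sub>0 'k) \<in> act_kernel E"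
  then have "act E (free_gen (Vert v)) \<phi> p = 0" if "\<phi> None = 0" for \<phi> :: "_ \<Rightarrow> 'k" and p
    using that by (simp add: act_kernel_def)
  from this[of "\<lambda>q. if q = None then 0 else 1" "Some (v, 0)"] show False
    using assms by (simp add: act_letter)
qed

end

section \<open>Quotients by ideals\<close>

context nonunital_algebra
begin

lemma ideal_coset_eq_zero_iff:
  assumes J: "two_sided_ideal A J" and a: "a \<in> acarrier A"
  shows "ideal_coset A J a = azero (quotient_algebra A J) \<longleftrightarrow> a \<in> J"
proof -
  have zero: "ideal_coset A J (azero A) = J"
    using add_zero ideal_in_carrier[OF J] by (force simp: ideal_coset_def)
  show ?thesis
    using ideal_coset_self[OF J a] ideal_coset_absorb[OF J zero_closed, of a] a
    by (auto simp: quotient_algebra_def zero add_zero)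
qed

lemma two_sided_ideal_preimage:
  assumes I: "two_sided_ideal A I" and J: "two_sided_ideal (quotient_algebra A I) J"
  shows "two_sided_ideal A {a \<in> acarrier A. ideal_coset A I a \<in> J}"
proof -
  let ?Q = "quotient_algebra A I"
  have car: "ideal_coset A I a \<in> acarrier ?Q" if "a \<in> acarrier A" for a
    using that by (simp add: quotient_algebra_def)
  have "azero ?Q = ideal_coset A I (azero A)" by (simp add: quotient_algebra_def)
  then show ?thesis
    using J car unfolding two_sided_ideal_def
    by (auto simp: zero_closed add_closed mult_closed scale_closed
        simp flip: quotient_add[OF I] quotient_mult[OF I] quotient_scale[OF I])
qed

lemma ideal_subset_preimage:
  assumes I: "two_sided_ideal A I" and J: "two_sided_ideal (quotient_algebra A I) J"
  shows "I \<subseteq> {a \<in> acarrier A. ideal_coset A I a \<in> J}"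
proof
  fix a assume a: "a \<in> I"
  then have c: "a \<in> acarrier A" by (rule ideal_in_carrier[OF I])
  then have "ideal_coset A I a = azero (quotient_algebra A I)"
    using ideal_coset_eq_zero_iff[OF I] a by blast
  then show "a \<in> {a \<in> acarrier A. ideal_coset A I a \<in> J}"
    using J c by (auto simp: two_sided_ideal_def)
qed

text \<open>The isomorphism is built from \<open>B\<close> to the quotient by choosing preimages
  under \<open>\<phi>\<close>. The choice is immaterial because elements with equal images have
  equal cosets.\<close>

theorem first_isomorphism:
  assumes I: "two_sided_ideal A I" and B: "nonunital_algebra B"
    and image: "\<phi> ` acarrier A = acarrier B"
    and add: "\<And>x y. x \<in> acarrier A \<Longrightarrow> y \<in> acarrier A \<Longrightarrow> \<phi> (aadd A x y) = aadd B (\<phi> x) (\<phi> y)"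
    and mult: "\<And>x y. x \<in> acarrier A \<Longrightarrow> y \<in> acarrier A \<Longrightarrow> \<phi> (amult A x y) = amult B (\<phi> x) (\<phi> y)"
    and scale: "\<And>c x. x \<in> acarrier A \<Longrightarrow> \<phi> (ascale A c x) = ascale B c (\<phi> x)"
    and kernel: "\<And>x. x \<in> acarrier A \<Longrightarrow> \<phi> x = azero B \<longleftrightarrow> x \<in> I"
  shows "algebra_isomorphic B (quotient_algebra A I)"
proof -
  interpret B: nonunital_algebra B by (rule B)
  let ?Q = "quotient_algebra A I" and ?q = "ideal_coset A I"
  have eq: "?q a = ?q b \<longleftrightarrow> \<phi> a = \<phi> b" if a: "a \<in> acarrier A" and b: "b \<in> acarrier A" for a b
  proof
    assume "?q a = ?q b"
    then obtain x where x: "x \<in> I" "a = aadd A b x"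
      using ideal_coset_self[OF I a] by (auto simp: ideal_coset_def)
    then have "\<phi> x = azero B" using kernel ideal_in_carrier[OF I] by blast
    then show "\<phi> a = \<phi> b"
      using x b add ideal_in_carrier[OF I x(1)] image
      by (metis B.add_commute B.add_zero B.zero_closed image_eqI)
  next
    assume eq: "\<phi> a = \<phi> b"
    let ?x = "aadd A a (ascale A (- 1) b)"
    have "\<phi> ?x = azero B"
    proof -
      have "\<phi> b \<in> acarrier B" using b image by blast
      then show ?thesis using a b by (simp add: eq add scale scale_closed B.add_inverse)
    qed
    then have x: "?x \<in> I" using kernel a b add_closed scale_closed by blast
    have "a = aadd A b ?x"
    proof -
      have "aadd A b ?x = aadd A (aadd A a (ascale A (- 1) b)) b"
        using a b by (simp add: add_commute add_closed scale_closed)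
      also have "\<dots> = aadd A a (aadd A b (ascale A (- 1) b))"
        using a b by (simp add: add_assoc add_commute scale_closed)
      also have "\<dots> = a" using a b by (simp add: add_inverse) (metis add_commute add_zero zero_closed)
      finally show ?thesis by simp
    qed
    then show "?q a = ?q b" using ideal_coset_absorb[OF I b x] by simp
  qed
  define f where "f = (\<lambda>y. ?q (SOME a. a \<in> acarrier A \<and> \<phi> a = y))"
  have f: "f (\<phi> a) = ?q a" if a: "a \<in> acarrier A" for a
  proof -
    have "(SOME b. b \<in> acarrier A \<and> \<phi> b = \<phi> a) \<in> acarrier A \<and>
        \<phi> (SOME b. b \<in> acarrier A \<and> \<phi> b = \<phi> a) = \<phi> a"
      by (rule someI) (use a in auto)
    then show ?thesis using a by (simp add: f_def eq)
  qed
  have "bij_betw f (acarrier B) (acarrier ?Q)"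
  proof (rule bij_betw_imageI)
    show "inj_on f (acarrier B)" by (auto simp: inj_on_def f eq simp flip: image)
    show "f ` acarrier B = acarrier ?Q"
      by (auto simp: f quotient_algebra_def image_image simp flip: image)
  qed
  then have "algebra_iso B ?Q f"
    unfolding algebra_iso_def
    by (auto simp: f add_closed mult_closed scale_closed quotient_add[OF I] quotient_mult[OF I]
        quotient_scale[OF I] simp flip: image add mult scale)
  then show ?thesis by (auto simp: algebra_isomorphic_def)
qed

end

section \<open>Ideals of the word algebra versus ideals of the non-unital algebra\<close>

lemma two_sided_ideal_inter_carrier:
  fixes I :: "('x list \<Rightarrow>\<^sub>0 'k::field) set"
  assumes I: "ring_ideal I"
  shows "two_sided_ideal (free_algebra X) (I \<inter> acarrier (free_algebra X))"
proof -
  interpret nonunital_algebra "free_algebra X :: ('k, 'x list \<Rightarrow>\<^sub>0 'k) algebra_structure"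
    by (rule nonunital_algebra_free_algebra)
  show ?thesis
    using zero_closed add_closed mult_closed scale_closed
      ring_ideal_zero[OF I] ring_ideal_add[OF I] ring_ideal_mult_left[OF I] ring_ideal_mult_right[OF I]
    unfolding two_sided_ideal_def by (auto simp: free_algebra_simps map_times_eq)
qed

lemma presented_ideal_subset:
  fixes I :: "('x list \<Rightarrow>\<^sub>0 'k::field) set"
  assumes "ring_ideal I" "R \<subseteq> I" "R \<subseteq> acarrier (free_algebra X)"
  shows "presented_ideal X R \<subseteq> I"
proof -
  have "presented_ideal X R \<subseteq> I \<inter> acarrier (free_algebra X)"
    unfolding presented_ideal_def using assms
    by (intro hull_minimal two_sided_ideal_inter_carrier) auto
  then show ?thesis by blast
qed

lemma lpa_ideal_extend_ideal:
  assumes "wf_digraph E" "two_sided_ideal (free_algebra (lpa_gens E)) J" "lpa_relations E \<subseteq> J"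
  shows "lpa_ideal E (extend_ideal (lpa_gens E) J)"
proof -
  interpret wf_digraph E by fact
  show ?thesis
    using ring_ideal_extend_ideal[OF assms(2)] subset_extend_ideal[OF assms(2)] assms(3)
      foreign_letter_in_extend_ideal[OF assms(2)]
    by unfold_locales auto
qed

section \<open>Condition (L) for the quotient graph\<close>

text \<open>This is the relative form of \<open>perp\<close>: products need only vanish modulo
  \<open>I\<close>.\<close>

definition annihilator :: "'r::ring_1 set \<Rightarrow> 'r set \<Rightarrow> 'r set" where
  "annihilator I J = {a. \<forall>x\<in>J. a * x \<in> I \<and> x * a \<in> I}"

lemma ring_ideal_annihilator:
  fixes I :: "'r::ring_1 set"
  assumes I: "ring_ideal I" and J: "ring_ideal J"
  shows "ring_ideal (annihilator I J)"
  using ring_ideal_zero[OF I] ring_ideal_add[OF I] ring_ideal_mult_left[OF I] ring_ideal_mult_right[OF I]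
    ring_ideal_mult_left[OF J] ring_ideal_mult_right[OF J]
  unfolding ring_ideal_def annihilator_def
  by (auto simp: distrib_left distrib_right mult.assoc) (metis mult.assoc)+

lemma subset_annihilator:
  assumes "ring_ideal I" shows "I \<subseteq> annihilator I J"
  using ring_ideal_mult_left[OF assms] ring_ideal_mult_right[OF assms] by (auto simp: annihilator_def)

context lpa_ideal
begin

text \<open>Modulo \<open>I\<close>, the head of an edge equals
  \<open>Gh e * V (tail E e) * Ed e\<close>.\<close>

lemma ideal_hereditary:
  assumes K: "ring_ideal K" "I \<subseteq> K"
  shows "awalk u p v \<Longrightarrow> V u \<in> K \<Longrightarrow> V v \<in> K"
proof (induction p arbitrary: u)
  case (Cons e p)
  then have e: "e \<in> arcs E" "u = tail E e" "awalk (head E e) p v" by (auto simp: awalk_simps)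
  have "V (head E e) \<approx> Gh e * Ed e" by (rule cong_sym[OF Gh_Ed_eq[OF e(1)]])
  also have "\<dots> \<approx> Gh e * (V u * Ed e)" unfolding e(2) by (rule cong_mult_left[OF cong_sym[OF V_Ed]])
  finally have "V (head E e) - Gh e * (V u * Ed e) \<in> K" using K(2) by (auto simp: cong_def)
  moreover have "Gh e * (V u * Ed e) \<in> K"
    using Cons.prems(2) ring_ideal_mult_left[OF K(1)] ring_ideal_mult_right[OF K(1)] by blast
  ultimately have "V (head E e) \<in> K" using ring_ideal_cong[OF K(1)] by blast
  then show ?case using Cons.IH e(3) by blast
qed (auto simp: awalk_simps)

text \<open>Reducing the nonzero product of \<open>x\<close> and \<open>V v\<close> to a vertex
  \<open>w\<close> leaves a nonzero product with \<open>V w\<close> at one end and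
  \<open>V v\<close> at the other. So \<open>v\<close> and \<open>w\<close> have a common
  descendant, which lies in \<open>K\<close> because \<open>V w\<close> does.\<close>

lemma vertex_in_annihilator_cases:
  assumes rf: "row_finite E" and L: "condition_L E" and nz: "\<And>v. v \<in> verts E \<Longrightarrow> V v \<notin> I"
    and K: "ring_ideal K" "I \<subseteq> K"
    and x: "x \<in> K" "[] \<notin> Poly_Mapping.keys x" "V v * x \<notin> I \<or> x * V v \<notin> I"
  shows "\<exists>p u. awalk v p u \<and> V u \<in> K"
proof -
  define y where "y = (if V v * x \<notin> I then V v * x else x * V v)"
  have y: "y \<notin> I" "[] \<notin> Poly_Mapping.keys y" "y \<in> K"
    using x nonconstant_mult[OF x(2)] ring_ideal_mult_left[OF K(1)] ring_ideal_mult_right[OF K(1)]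
    by (auto simp: y_def)
  obtain a b w where w: "w \<in> verts E" "a * y * b \<approx> V w" using reduction[OF rf L y(2,1)] by blast
  have wK: "V w \<in> K"
  proof -
    have "a * y * b - V w \<in> K" using w(2) K(2) by (auto simp: cong_def)
    moreover have "a * y * b \<in> K"
      using y(3) ring_ideal_mult_left[OF K(1)] ring_ideal_mult_right[OF K(1)] by blast
    ultimately show ?thesis using ring_ideal_cong[OF K(1)] by blast
  qed
  have ww: "V w * V w \<notin> I" using cong_in_I[OF V_idem] nz[OF w(1)] by blast
  have "\<exists>u p q. awalk w p u \<and> awalk v q u"
  proof (cases "V v * x \<notin> I")
    case True
    have "V w * (a * y * b) \<notin> I" using ww cong_in_I[OF cong_mult_left[OF w(2)]] by blast
    then have "V w * a * V v * (x * b) \<notin> I" using True by (simp add: y_def mult.assoc)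
    then have "V w * a * V v \<notin> I" using I_mult_right by blast
    then show ?thesis by (rule common_descendant[OF rf])
  next
    case False
    have "(a * y * b) * V w \<notin> I" using ww cong_in_I[OF cong_mult_right[OF w(2)]] by blast
    then have "a * x * (V v * b * V w) \<notin> I" using False by (simp add: y_def mult.assoc)
    then have "V v * b * V w \<notin> I" using I_mult_left by blast
    from common_descendant[OF rf this] show ?thesis by blast
  qed
  then show ?thesis using ideal_hereditary[OF K] wK by blast
qed

lemma condition_L_quotient_graph:
  assumes rf: "row_finite E" and L: "condition_L E" and nz: "\<And>v. v \<in> verts E \<Longrightarrow> V v \<notin> I"
    and J: "ring_ideal J" "I \<subseteq> J"
    and regular: "\<And>v. v \<in> verts E \<Longrightarrow> V v \<notin> J \<Longrightarrow>
      \<exists>x\<in>annihilator I J. [] \<notin> Poly_Mapping.keys x \<and> (V v * x \<notin> I \<or> x * V v \<notin> I)"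
    and H: "H = {v \<in> verts E. V v \<in> J}"
  shows "condition_L (quotient_graph E H)"
  unfolding condition_L_def
proof (intro allI impI; rule ccontr)
  let ?Q = "quotient_graph E H" and ?K = "annihilator I J"
  fix c assume c: "pre_digraph.cycle ?Q c" and no_exit: "\<nexists>e. is_exit ?Q c e"
  have K: "ring_ideal ?K" "I \<subseteq> ?K"
    using ring_ideal_annihilator[OF ideal J(1)] subset_annihilator[OF ideal] by auto
  have not_both: False if "u \<in> verts E" "V u \<in> J" "V u \<in> ?K" for u
  proof -
    have "V u * V u \<in> I" using that by (auto simp: annihilator_def)
    then show False using cong_in_I[OF V_idem] nz that(1) by blast
  qed
  have cas: "pre_digraph.cas ?Q x p y = cas x p y" for x p y
    by (induction p arbitrary: x) (auto simp: pre_digraph.cas.simps quotient_graph_def)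
  have av: "pre_digraph.awalk_verts ?Q x p = awalk_verts x p" for x p
    by (induction p arbitrary: x) (auto simp: pre_digraph.awalk_verts.simps quotient_graph_def)
  obtain x where x: "awalk x c x" "c \<noteq> []" "distinct (tl (awalk_verts x c))"
    and cQ: "x \<notin> H" "\<And>e. e \<in> set c \<Longrightarrow> e \<in> arcs E \<and> head E e \<notin> H"
    using c by (auto simp: pre_digraph.cycle_def pre_digraph.awalk_def cas av awalk_def)
      (auto simp: quotient_graph_def)
  have stay: "f \<in> set c" if f: "f \<in> arcs E" "head E f \<notin> H" "g \<in> set c" "tail E f = tail E g" for f g
  proof (rule ccontr)
    assume "f \<notin> set c"
    then have "is_exit ?Q c f"
      using f by (auto simp: is_exit_def quotient_graph_def in_set_conv_nth)
    then show False using no_exit by blast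
  qed
  \<comment> \<open>Cutting the cycle at \<open>e\<close> gives a walk from \<open>x\<close> to
    \<open>e\<close> and one from \<open>e\<close> back to \<open>x\<close>.\<close>
  have split: "\<exists>p q. awalk x p (tail E e) \<and> awalk (head E e) q x \<and>
      (q = [] \<or> head E e = tail E (hd q) \<and> set q \<subseteq> set c)" if e: "e \<in> set c" for e
  proof -
    obtain as bs where "c = as @ e # bs" using e by (meson split_list)
    then show ?thesis using x(1)
      by (intro exI[of _ as] exI[of _ bs]) (cases bs; auto simp: awalk_simps)
  qed
  have hd_c: "hd c \<in> set c" "tail E (hd c) = x" using x by (cases c; auto simp: awalk_simps)+
  let ?T = "tail E ` set c"
  have x_T: "x \<in> ?T" using hd_c by (metis image_eqI)
  have next_T: "head E e \<in> ?T" if e: "e \<in> set c" for e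
  proof -
    obtain q where q: "awalk (head E e) q x" "q = [] \<or> head E e = tail E (hd q) \<and> set q \<subseteq> set c"
      using split[OF e] by blast
    show ?thesis
    proof (cases "q = []")
      case True
      then have "head E e = x" using q by (simp add: awalk_simps)
      then show ?thesis using x_T by simp
    next
      case False
      then show ?thesis using q by (metis hd_in_set image_eqI subsetD)
    qed
  qed
  \<comment> \<open>Without exits in the quotient graph, a walk can leave the cycle only into the
    hereditary set \<open>H\<close>.\<close>
  have reach: "u \<in> ?T \<union> H" if "awalk a q u" "a \<in> ?T \<union> H" for a q u
    using that
  proof (induction q arbitrary: a)
    case (Cons e q)
    then have e: "e \<in> arcs E" "a = tail E e" "awalk (head E e) q u" by (auto simp: awalk_simps)
    have "head E e \<in> ?T \<union> H"
    proof (cases "head E e \<in> H \<or> a \<in> H")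
      case True
      have "awalk a [e] (head E e)" using e by (simp add: awalk_simps)
      then show ?thesis using True ideal_hereditary[OF J] H e(1) by (auto simp: head_in_verts)
    next
      case False
      then obtain g where "g \<in> set c" "a = tail E g" using Cons.prems(2) by blast
      then show ?thesis using stay[of e g] False e next_T by auto
    qed
    then show ?case using Cons.IH e(3) by blast
  qed (auto simp: awalk_simps)
  have "x \<in> verts E" "V x \<notin> J" using x(1) cQ(1) H by auto
  then obtain y where "y \<in> ?K" "[] \<notin> Poly_Mapping.keys y" "V x * y \<notin> I \<or> y * V x \<notin> I"
    using regular by blast
  from vertex_in_annihilator_cases[OF rf L nz K this] obtain p u
    where u: "awalk x p u" "V u \<in> ?K" by blast
  have "u \<notin> H" using not_both[of u] u(2) H by blast
  then have "u \<in> ?T" using reach[OF u(1)] x_T by blast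
  then obtain e where e: "e \<in> set c" "u = tail E e" by blast
  have "cycle c" using x by (auto simp: cycle_def)
  then obtain f g where f: "f \<in> arcs E" "g \<in> set c" "tail E f = tail E g" "f \<noteq> g"
    using L by (metis condition_L_def is_exit_def nth_mem)
  have g_only: "f = g" if "head E f \<notin> H"
  proof (rule ccontr)
    assume "f \<noteq> g"
    then have "is_exit ?Q c f"
      using f that by (auto simp: is_exit_def quotient_graph_def in_set_conv_nth)
    then show False using no_exit by blast
  qed
  then have fH: "head E f \<in> H" using f by blast
  \<comment> \<open>The walk from \<open>u\<close> around the cycle through \<open>x\<close> to the
    tail of \<open>f\<close>, and then along \<open>f\<close>, carries membership in the annihilator
    to the head of \<open>f\<close>.\<close>
  obtain q where "awalk (head E e) q x" using split[OF e(1)] by blast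
  moreover have "awalk u [e] (head E e)" using e cQ(2) by (simp add: awalk_simps)
  moreover obtain p' where "awalk x p' (tail E f)" using split[OF f(2)] f(3) by auto
  moreover have "awalk (tail E f) [f] (head E f)" using f(1) by (simp add: awalk_simps)
  ultimately have "V (head E f) \<in> ?K" using u(2) ideal_hereditary[OF K] by blast
  then show False using not_both[of "head E f"] fH H by blast
qed

end

section \<open>Comparison of the two quotients\<close>

context lpa_ideal
begin

lemma arc_into_ideal:
  assumes "V (head E e) \<in> I" shows "Ed e \<in> I" "Gh e \<in> I"
  using cong_in_I[OF Ed_V[of e]] cong_in_I[OF V_Gh[of e]] I_mult_left[OF assms] I_mult_right[OF assms]
  by blast+

context
  fixes H assumes H: "H = {v \<in> verts E. V v \<in> I}"
begin

text \<open>A letter missing from the quotient graph is foreign to \<open>E\<close>, a vertex of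
  \<open>H\<close>, or an edge or ghost edge whose arc has head in \<open>H\<close>; all of these
  lie in \<open>I\<close>.\<close>

lemma foreign_quotient_graph: "foreign (lpa_gens (quotient_graph E H)) \<subseteq> I"
proof
  let ?X = "lpa_gens (quotient_graph E H)"
  have letter: "free_gen x \<in> I" if "x \<notin> ?X" for x
    using that foreign_letters[of x]
    by (cases x) (auto simp: lpa_gens_def quotient_graph_def H image_iff intro: arc_into_ideal)
  have word: "word_poly w \<in> I" if "\<not> set w \<subseteq> ?X" for w
    using that by (induction w) (auto simp: word_poly_Cons intro: I_mult_left I_mult_right letter)
  fix f :: "('v, 'e) lpa_gen list \<Rightarrow>\<^sub>0 'k" assume f: "f \<in> foreign ?X"
  have "(\<Sum>w\<in>Poly_Mapping.keys f. const_poly (Poly_Mapping.lookup f w) * word_poly w) \<in> I"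
    using f word by (intro I_sum I_mult_left) (auto simp: foreign_def)
  then show "f \<in> I" by (simp flip: poly_eq_sum_words)
qed

text \<open>Only the summation relation changes: its sum loses the edges with head in
  \<open>H\<close>, whose terms lie in \<open>I\<close>. Row-finiteness makes a regular vertex of
  the quotient graph regular in \<open>E\<close>.\<close>

lemma lpa_relations_quotient_graph:
  assumes rf: "row_finite E"
  shows "lpa_relations (quotient_graph E H) \<subseteq> I"
proof -
  let ?Q = "quotient_graph E H"
  have CK2: "V v - (\<Sum>e\<in>out_arcs ?Q v. Ed e * Gh e) \<in> I" if v: "v \<in> regular_verts ?Q" for v
  proof -
    have out: "out_arcs ?Q v = {e \<in> out_arcs E v. head E e \<notin> H}"
      by (auto simp: quotient_graph_def out_arcs_def)
    have v': "v \<in> verts E" "finite (out_arcs E v)"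
      using v rf by (auto simp: regular_verts_def quotient_graph_def row_finite_def)
    moreover have "out_arcs E v \<noteq> {}" using v out by (auto simp: regular_verts_def)
    ultimately have "V v \<approx> (\<Sum>e\<in>out_arcs E v. Ed e * Gh e)"
      by (intro V_regular) (auto simp: regular_verts_def)
    also have "\<dots> = (\<Sum>e\<in>out_arcs ?Q v. Ed e * Gh e)
        + (\<Sum>e\<in>out_arcs E v - out_arcs ?Q v. Ed e * Gh e)"
      using v' out by (subst add.commute) (intro sum.subset_diff, auto)
    also have "\<dots> \<approx> (\<Sum>e\<in>out_arcs ?Q v. Ed e * Gh e) + 0"
    proof (intro cong_add cong_refl)
      have "V (head E e) \<in> I" if "e \<in> out_arcs E v - out_arcs ?Q v" for e
        using that H unfolding out by auto
      then show "(\<Sum>e\<in>out_arcs E v - out_arcs ?Q v. Ed e * Gh e) \<approx> 0"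
        unfolding cong_zero
        by (intro I_sum I_mult_left arc_into_ideal(2))
    qed
    finally show ?thesis by (simp add: cong_def)
  qed
  have sub: "v \<in> verts E" if "v \<in> verts ?Q" for v using that by (simp add: quotient_graph_def)
  have sub': "e \<in> arcs E" if "e \<in> arcs ?Q" for e using that by (simp add: quotient_graph_def)
  have ends: "tail ?Q = tail E" "head ?Q = head E" by (simp_all add: quotient_graph_def)
  have "lpa_relations ?Q \<subseteq> lpa_relations E \<union>
      {V v - (\<Sum>e\<in>out_arcs ?Q v. Ed e * Gh e) | v. v \<in> regular_verts ?Q}"
    unfolding lpa_relations_def ends using sub sub' by blast
  then show ?thesis using relations CK2 by blast
qed

end

end

lemma row_finite_quotient_graph:
  assumes "row_finite E" shows "row_finite (quotient_graph E H)"
proof -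
  have "out_arcs (quotient_graph E H) v \<subseteq> out_arcs E v" for v
    by (auto simp: quotient_graph_def out_arcs_def)
  then show ?thesis
    using assms by (auto simp: row_finite_def quotient_graph_def intro: finite_subset)
qed

lemma lpa_gens_quotient_graph: "lpa_gens (quotient_graph E H) \<subseteq> lpa_gens E"
  by (auto simp: lpa_gens_def quotient_graph_def)

section \<open>Both algebras as quotients of word algebras, and their comparison\<close>

theorem proposition3p10:
  fixes E :: "('v, 'e) pre_digraph"
    and J :: "(('v, 'e) lpa_gen list \<Rightarrow>\<^sub>0 'k::field) set set"
  assumes "countable_digraph E"
    and "row_finite E"
    and "condition_L E"
    and "regular_ideal (leavitt_path_algebra E) J"
  shows "condition_L (quotient_graph E (ideal_vertices E J)) \<and>
         algebra_isomorphic (quotient_algebra (leavitt_path_algebra E) J)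
           (leavitt_path_algebra (quotient_graph E (ideal_vertices E J)))"
proof -
  have wf: "wf_digraph E" using assms(1) by (simp add: countable_digraph_def)
  let ?X = "lpa_gens E" and ?R = "lpa_relations E :: (('v, 'e) lpa_gen list \<Rightarrow>\<^sub>0 'k) set"
  let ?A = "free_algebra ?X :: ('k, ('v, 'e) lpa_gen list \<Rightarrow>\<^sub>0 'k) algebra_structure"
  let ?I0 = "presented_ideal ?X ?R" and ?L = "leavitt_path_algebra E :: ('k, _) algebra_structure"
  interpret A: nonunital_algebra ?A by (rule nonunital_algebra_free_algebra)
  interpret L: nonunital_algebra ?L by (rule nonunital_algebra_leavitt_path_algebra[OF wf])
  note R = lpa_relations_in_carrier[OF wf]
  note I0 = two_sided_ideal_presented_ideal[OF R]
  have L_eq: "?L = quotient_algebra ?A ?I0"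
    by (simp add: leavitt_path_algebra_def presented_algebra_def)
  let ?q = "ideal_coset ?A ?I0"
  have J: "two_sided_ideal ?L J" and JJ: "J = perp ?L (perp ?L J)"
    using assms(4) by (auto simp: regular_ideal_def)
  define J0 where "J0 = {a \<in> acarrier ?A. ?q a \<in> J}"
  have J0: "two_sided_ideal ?A J0" and I0_J0: "?I0 \<subseteq> J0"
    unfolding J0_def using A.two_sided_ideal_preimage[OF I0] A.ideal_subset_preimage[OF I0] J L_eq by auto
  have R_I0: "?R \<subseteq> ?I0" unfolding presented_ideal_def by (rule hull_subset)
  \<comment> \<open>\<open>I\<close> and \<open>J1\<close> are the preimages of zero and of
    \<open>J\<close>, enlarged by everything foreign to \<open>E\<close>.\<close>
  define I where "I = extend_ideal ?X ?I0"
  define J1 where "J1 = extend_ideal ?X J0"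
  interpret I: lpa_ideal E I unfolding I_def by (rule lpa_ideal_extend_ideal[OF wf I0 R_I0])
  have "?R \<subseteq> J0" using R_I0 I0_J0 by (rule subset_trans)
  interpret J1: lpa_ideal E J1 unfolding J1_def by (rule lpa_ideal_extend_ideal[OF wf J0 \<open>?R \<subseteq> J0\<close>])
  have I_J1: "I \<subseteq> J1" using I0_J0 by (auto simp: I_def J1_def extend_ideal_def)
  have I_iff: "a \<in> I \<longleftrightarrow> a \<in> ?I0" if "a \<in> acarrier ?A" for a
    using extend_ideal_inter_carrier[OF I0] subset_extend_ideal[OF I0] that by (auto simp: I_def)
  have J1_iff: "a \<in> J1 \<longleftrightarrow> ?q a \<in> J" if "a \<in> acarrier ?A" for a
    using extend_ideal_inter_carrier[OF J0] subset_extend_ideal[OF J0] that by (auto simp: J1_def J0_def)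
  have q_zero: "?q a = azero ?L \<longleftrightarrow> a \<in> ?I0" if "a \<in> acarrier ?A" for a
    using A.ideal_coset_eq_zero_iff[OF I0 that] L_eq by simp
  have q_mult: "amult ?L (?q a) (?q b) = ?q (a * b)" if "a \<in> acarrier ?A" "b \<in> acarrier ?A" for a b
    using A.quotient_mult[OF I0 that] L_eq by (simp add: free_algebra_simps)
  have mult_closed: "a * b \<in> acarrier ?A" if "a \<in> acarrier ?A" "b \<in> acarrier ?A" for a b
    using A.mult_closed[OF that] by (simp add: free_algebra_simps)
  have L_car: "acarrier ?L = ?q ` acarrier ?A" by (simp add: L_eq quotient_algebra_def)
  have V_car: "I.V v \<in> acarrier ?A" if "v \<in> verts E" for v
    using that by (simp add: carrier_free_algebra free_gen_def lpa_gens_def)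
  \<comment> \<open>Vertices act nontrivially on functions, whereas the Leavitt relations act as
    zero.\<close>
  have nz: "I.V v \<notin> I" if v: "v \<in> verts E" for v
  proof
    assume "I.V v \<in> I"
    then have "I.V v \<in> ?I0" using I_iff V_car v by blast
    then have "I.V v \<in> act_kernel E"
      using presented_ideal_subset[OF ring_ideal_act_kernel lpa_relations_act_kernel[OF wf assms(2)] R]
      by blast
    then show False using Vert_notin_act_kernel[OF wf assms(2) v] by blast
  qed
  define H where "H = ideal_vertices E J"
  have H: "H = {v \<in> verts E. I.V v \<in> J1}"
    using J1_iff V_car by (auto simp: H_def ideal_vertices_def lpa_vertex_def presented_gen_def)
  let ?F = "quotient_graph E H"
  have "\<exists>x\<in>annihilator I J1. [] \<notin> Poly_Mapping.keys x \<and> (I.V v * x \<notin> I \<or> x * I.V v \<notin> I)"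
    if v: "v \<in> verts E" "I.V v \<notin> J1" for v
  proof -
    have vA: "I.V v \<in> acarrier ?A" using V_car v by blast
    \<comment> \<open>Regularity enters here: a vertex outside \<open>J\<close> fails to annihilate
      some \<open>y\<close> in the annihilator of \<open>J\<close>, and a preimage of
      \<open>y\<close> is the witness sought.\<close>
    have "?q (I.V v) \<notin> perp ?L (perp ?L J)" using J1_iff[OF vA] v(2) JJ by blast
    moreover have "?q (I.V v) \<in> acarrier ?L" using vA L_car by blast
    ultimately obtain y where y: "y \<in> perp ?L J"
      "amult ?L (?q (I.V v)) y \<noteq> azero ?L \<or> amult ?L y (?q (I.V v)) \<noteq> azero ?L"
      by (auto simp: perp_def)
    then obtain x where x: "x \<in> acarrier ?A" "y = ?q x" using L_car by (auto simp: perp_def)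
    have ann: "x * a \<in> ?I0 \<and> a * x \<in> ?I0" if "a \<in> J0" for a
    proof -
      have a: "a \<in> acarrier ?A" "?q a \<in> J" using that by (auto simp: J0_def)
      then have "?q (x * a) = azero ?L" "?q (a * x) = azero ?L"
        using y(1) x by (auto simp: perp_def q_mult)
      then show ?thesis using q_zero mult_closed a x by blast
    qed
    have "x * b \<in> I \<and> b * x \<in> I" if b: "b \<in> J1" for b
    proof -
      obtain a where a: "a \<in> J0" "b - a \<in> foreign ?X" using b by (auto simp: J1_def extend_ideal_def)
      have "x * (b - a) \<in> foreign ?X" "(b - a) * x \<in> foreign ?X"
        using a(2) ring_ideal_mult_left[OF ring_ideal_foreign] ring_ideal_mult_right[OF ring_ideal_foreign]
        by blast+
      then have "x * b - x * a \<in> foreign ?X" "b * x - a * x \<in> foreign ?X" by (simp_all add: algebra_simps)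
      then show ?thesis unfolding I_def extend_ideal_def using ann[OF a(1)] by blast
    qed
    then have "x \<in> annihilator I J1" by (auto simp: annihilator_def)
    moreover have "I.V v * x \<notin> I \<or> x * I.V v \<notin> I"
      using y(2) I_iff q_zero mult_closed vA x by (auto simp: q_mult)
    ultimately show ?thesis using x(1) carrier_free_algebra by blast
  qed
  then have F_L: "condition_L ?F"
    by (intro I.condition_L_quotient_graph[OF assms(2,3) nz J1.ideal I_J1 _ H]) auto
  have wfF: "wf_digraph ?F"
    unfolding H_def by (rule wf_digraph_quotient_graph[OF wf hereditary_ideal_vertices[OF wf J]])
  let ?XF = "lpa_gens ?F" and ?RF = "lpa_relations ?F :: (('v, 'e) lpa_gen list \<Rightarrow>\<^sub>0 'k) set"
  let ?AF = "free_algebra ?XF :: ('k, ('v, 'e) lpa_gen list \<Rightarrow>\<^sub>0 'k) algebra_structure"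
  let ?IF = "presented_ideal ?XF ?RF"
  interpret AF: nonunital_algebra ?AF by (rule nonunital_algebra_free_algebra)
  note RF = lpa_relations_in_carrier[OF wfF]
  note IF = two_sided_ideal_presented_ideal[OF RF]
  define I1 where "I1 = extend_ideal ?XF ?IF"
  have "?RF \<subseteq> ?IF" unfolding presented_ideal_def by (rule hull_subset)
  interpret I1: lpa_ideal ?F I1 unfolding I1_def by (rule lpa_ideal_extend_ideal[OF wfF IF \<open>?RF \<subseteq> ?IF\<close>])
  have AF_A: "acarrier ?AF \<subseteq> acarrier ?A"
    using lpa_gens_quotient_graph[of E H] unfolding carrier_free_algebra subset_iff by blast
  have foreign_J1: "foreign ?XF \<subseteq> J1" by (rule J1.foreign_quotient_graph[OF H])
  have IF_J1: "?IF \<subseteq> J1"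
    by (rule presented_ideal_subset[OF J1.ideal J1.lpa_relations_quotient_graph[OF H assms(2)] RF])
  have I1_J1: "I1 \<subseteq> J1"
  proof
    fix f assume "f \<in> I1"
    then obtain a where "a \<in> ?IF" "f - a \<in> foreign ?XF" by (auto simp: I1_def extend_ideal_def)
    then show "f \<in> J1" using foreign_J1 IF_J1 ring_ideal_cong[OF J1.ideal] by blast
  qed
  \<comment> \<open>An element of \<open>J1\<close> outside \<open>?IF\<close> would reduce to a
    vertex of \<open>?F\<close> lying in \<open>J1\<close>, but the vertices of \<open>?F\<close>
    are those outside \<open>H\<close>.\<close>
  have kernel: "x \<in> J1 \<longleftrightarrow> x \<in> ?IF" if x: "x \<in> acarrier ?AF" for x
  proof
    assume xJ: "x \<in> J1"
    show "x \<in> ?IF"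
    proof (rule ccontr)
      assume "x \<notin> ?IF"
      then have "x \<notin> I1" using extend_ideal_inter_carrier[OF IF] x by (auto simp: I1_def)
      moreover have "[] \<notin> Poly_Mapping.keys x" using x by (simp add: carrier_free_algebra)
      ultimately obtain a b v where v: "v \<in> verts ?F" "I1.cong (a * x * b) (I1.V v)"
        using I1.reduction[OF row_finite_quotient_graph[OF assms(2)] F_L] by blast
      then have "a * x * b - I1.V v \<in> J1" using I1_J1 by (auto simp: I1.cong_def)
      moreover have "a * x * b \<in> J1" using xJ J1.I_mult_left J1.I_mult_right by blast
      ultimately have "I1.V v \<in> J1" using ring_ideal_cong[OF J1.ideal] by blast
      then show False using v(1) H by (auto simp: quotient_graph_def)
    qed
  qed (use IF_J1 in blast)
  let ?B = "quotient_algebra ?L J" and ?p = "ideal_coset ?L J"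
  have p_eq: "?p (?q a) = ?p (?q b)" if "a \<in> acarrier ?A" "b \<in> acarrier ?A" "a - b \<in> J1" for a b
  proof -
    have "a - b = aadd ?A a (ascale ?A (- 1) b)"
      by (simp add: free_algebra_simps map_times_eq single_uminus const_poly_one)
    then have c: "a - b \<in> acarrier ?A" using A.add_closed A.scale_closed that(1,2) by metis
    then have "?q (a - b) \<in> J" using J1_iff that(3) by blast
    moreover have "aadd ?L (?q b) (?q (a - b)) = ?q a"
      using A.quotient_add[OF I0 that(2) c] L_eq by (simp add: free_algebra_simps)
    moreover have "?q b \<in> acarrier ?L" using L_car that(2) by blast
    ultimately show ?thesis using L.ideal_coset_absorb[OF J] by metis
  qed
  \<comment> \<open>The map includes words over the generators of \<open>?F\<close> among those of
    \<open>E\<close> and then takes both cosets.\<close>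
  have "algebra_isomorphic ?B (quotient_algebra ?AF ?IF)"
  proof (rule AF.first_isomorphism[OF IF L.nonunital_algebra_quotient[OF J], where \<phi> = "\<lambda>a. ?p (?q a)"])
    show "(\<lambda>a. ?p (?q a)) ` acarrier ?AF = acarrier ?B"
    proof
      show "(\<lambda>a. ?p (?q a)) ` acarrier ?AF \<subseteq> acarrier ?B"
        using AF_A by (auto simp: quotient_algebra_def L_car)
      show "acarrier ?B \<subseteq> (\<lambda>a. ?p (?q a)) ` acarrier ?AF"
      proof
        fix z assume "z \<in> acarrier ?B"
        then obtain a where a: "a \<in> acarrier ?A" "z = ?p (?q a)"
          by (auto simp: quotient_algebra_def L_car)
        \<comment> \<open>Dropping the monomials with letters missing from \<open>?F\<close> changes
          \<open>a\<close> by an element of \<open>J1\<close> only, so \<open>b\<close> represents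
          the same class.\<close>
        obtain b where b: "a - b \<in> foreign ?XF" "\<And>w. w \<in> Poly_Mapping.keys b \<Longrightarrow> set w \<subseteq> ?XF"
          "Poly_Mapping.keys b \<subseteq> Poly_Mapping.keys a"
          by (rule foreign_decomposition[of a ?XF]) blast
        have "b \<in> acarrier ?AF" using a(1) b(2,3) by (auto simp: carrier_free_algebra)
        moreover have "?p (?q a) = ?p (?q b)"
          using p_eq a(1) calculation AF_A b(1) foreign_J1 by blast
        ultimately show "z \<in> (\<lambda>a. ?p (?q a)) ` acarrier ?AF" using a(2) by blast
      qed
    qed
  next
    fix x y assume xy: "x \<in> acarrier ?AF" "y \<in> acarrier ?AF"
    then have c: "x \<in> acarrier ?A" "y \<in> acarrier ?A" using AF_A by auto
    then have qc: "?q x \<in> acarrier ?L" "?q y \<in> acarrier ?L" using L_car by auto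
    show "?p (?q (aadd ?AF x y)) = aadd ?B (?p (?q x)) (?p (?q y))"
      using A.quotient_add[OF I0 c] L.quotient_add[OF J qc] L_eq by (simp add: free_algebra_simps)
    show "?p (?q (amult ?AF x y)) = amult ?B (?p (?q x)) (?p (?q y))"
      using L.quotient_mult[OF J qc] q_mult[OF c] by (simp add: free_algebra_simps)
  next
    fix c x assume "x \<in> acarrier ?AF"
    then have x: "x \<in> acarrier ?A" using AF_A by auto
    then have qx: "?q x \<in> acarrier ?L" using L_car by auto
    show "?p (?q (ascale ?AF c x)) = ascale ?B c (?p (?q x))"
      using A.quotient_scale[OF I0 x] L.quotient_scale[OF J qx] L_eq by (simp add: free_algebra_simps)
  next
    fix x assume xF: "x \<in> acarrier ?AF"
    then have x: "x \<in> acarrier ?A" using AF_A by auto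
    then have qx: "?q x \<in> acarrier ?L" using L_car by auto
    show "?p (?q x) = azero ?B \<longleftrightarrow> x \<in> ?IF"
      using L.ideal_coset_eq_zero_iff[OF J qx] J1_iff[OF x] kernel[OF xF] by simp
  qed
  then show ?thesis
    using F_L by (simp add: H_def leavitt_path_algebra_def[of "quotient_graph E (ideal_vertices E J)"] presented_algebra_def)
qed

end
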